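(* Let $(M_1,g_1)$ and $(M_2,g_2)$ be Riemannian manifolds and let $N=M_1\times M_2$ be their Riemannian product, with product metric $g$. Let $\tau_1,\tau_2,\tau$ and $\kappa_1,\kappa_2,\kappa$ be the tension fields and conformality operators on $M_1$, $M_2$ and $N$, respectively. Suppose that $\phi_1:M_1\to\mathbb C$ and $\phi_2:M_2\to\mathbb C$ are eigenfunctions satisfying, with $\lambda_1,\mu_1,\lambda_2,\mu_2\in\mathbb C$, $$\tau_1(\phi_1)=\lambda_1\cdot\phi_1,\quad \kappa_1(\phi_1,\phi_1)=\mu_1\cdot\phi_1^2$$ and $$\tau_2(\phi_2)=\lambda_2\cdot\phi_2,\quad \kappa_2(\phi_2,\phi_2)=\mu_2\cdot\phi_2^2.$$ Define $\psi:N\to\mathbb C$ by $\psi(p_1,p_2)=\phi_1(p_1)\cdot\phi_2(p_2)$. Then $\psi$ is an eigenfunction on $N$ with $$\tau(\psi)=(\lambda_1+\lambda_2)\cdot\psi\quad\text{and}\quad\kappa(\psi,\psi)=(\mu_1+\mu_2)\cdot\psi^2.$$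
   Context: On a Riemannian manifold $(M,g)$, with $g$ extended complex-bilinearly to the complexified tangent bundle, the tension field of a complex-valued function $f$ is $\tau(f)=\operatorname{div}(\nabla f)$ and the conformality operator is $\kappa(f,h)=g(\nabla f,\nabla h)$. A smooth function $\phi:M\to\mathbb C$ is an eigenfunction if there exist $\lambda,\mu\in\mathbb C$ with $\tau(\phi)=\lambda\cdot\phi$ and $\kappa(\phi,\phi)=\mu\cdot\phi^2$. *)

theory Defs
  imports "HOL-Analysis.Analysis"
begin

section \<open>Smooth maps between Euclidean spaces\<close>

text \<open>Used for open \<open>S\<close> only, where \<open>Ck_on k S f\<close> says that \<open>f\<close> is of class \<open>C\<^sup>k\<close> on \<open>S\<close>.\<close>

primrec Ck_on :: "nat \<Rightarrow> 'e::euclidean_space set \<Rightarrow> ('e \<Rightarrow> 'f::real_normed_vector) \<Rightarrow> bool" where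
  "Ck_on 0 S f \<longleftrightarrow> continuous_on S f"
| "Ck_on (Suc k) S f \<longleftrightarrow>
     (\<forall>x\<in>S. f differentiable (at x)) \<and> (\<forall>v. Ck_on k S (\<lambda>x. frechet_derivative f (at x) v))"

definition smooth_on :: "'e::euclidean_space set \<Rightarrow> ('e \<Rightarrow> 'f::real_normed_vector) \<Rightarrow> bool" where
  "smooth_on S f \<longleftrightarrow> (\<forall>k. Ck_on k S f)"


section \<open>Charts and Riemannian manifolds\<close>

text \<open>A chart is a domain together with a coordinate map; the values of the coordinate map outside
  the domain are irrelevant.\<close>

datatype ('a, 'e) chart = Chart (cdom: "'a set") (coord: "'a \<Rightarrow> 'e")

definition cimage :: "('a, 'e) chart \<Rightarrow> 'e set" where
  "cimage c = coord c ` cdom c"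

definition param :: "('a, 'e) chart \<Rightarrow> 'e \<Rightarrow> 'a" where
  "param c = inv_into (cdom c) (coord c)"

definition is_chart :: "('a::topological_space, 'e::euclidean_space) chart \<Rightarrow> bool" where
  "is_chart c \<longleftrightarrow> open (cdom c) \<and> open (cimage c) \<and>
     homeomorphism (cdom c) (cimage c) (coord c) (param c)"

definition transition :: "('a, 'e) chart \<Rightarrow> ('a, 'e) chart \<Rightarrow> 'e \<Rightarrow> 'e" where
  "transition c d = coord d \<circ> param c"

definition smooth_atlas :: "('a::topological_space, 'e::euclidean_space) chart set \<Rightarrow> bool" where
  "smooth_atlas A \<longleftrightarrow> (\<forall>c\<in>A. is_chart c) \<and> (\<Union>c\<in>A. cdom c) = UNIV \<and>
     (\<forall>c\<in>A. \<forall>d\<in>A. smooth_on (coord c ` (cdom c \<inter> cdom d)) (transition c d))"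

text \<open>Charts take values in the model space \<open>'e\<close>. Each point \<open>p\<close> carries a distinguished chart
  \<open>chart_at M p\<close> of the atlas, which is only used to name tangent vectors: the tangent space at
  \<open>p\<close> is \<open>'e\<close>, where \<open>u\<close> stands for the tangent vector at \<open>p\<close> whose coordinates with respect to
  \<open>chart_at M p\<close> are \<open>u\<close>. So \<open>metric M p\<close> is the inner product on the tangent space at \<open>p\<close>, and a
  vector field is a function \<open>X :: 'a \<Rightarrow> 'e\<close>.\<close>

record ('a, 'e) riem =
  atlas :: "('a, 'e) chart set"
  chart_at :: "'a \<Rightarrow> ('a, 'e) chart"
  metric :: "'a \<Rightarrow> 'e \<Rightarrow> 'e \<Rightarrow> real"

text \<open>The change of coordinates of tangent vectors at \<open>p\<close> from the chart \<open>c\<close> to the chart \<open>d\<close>.\<close>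

definition tangent_change ::
    "('a, 'e::euclidean_space) chart \<Rightarrow> ('a, 'e) chart \<Rightarrow> 'a \<Rightarrow> 'e \<Rightarrow> 'e" where
  "tangent_change c d p = frechet_derivative (transition c d) (at (coord c p))"

definition local_metric ::
    "('a, 'e::euclidean_space) riem \<Rightarrow> ('a, 'e) chart \<Rightarrow> 'e \<Rightarrow> 'e \<Rightarrow> 'e \<Rightarrow> real" where
  "local_metric M c x u v =
     (let p = param c x; T = tangent_change c (chart_at M p) p in metric M p (T u) (T v))"

definition local_field ::
    "('a, 'e::euclidean_space) riem \<Rightarrow> ('a, 'e) chart \<Rightarrow> ('a \<Rightarrow> 'e) \<Rightarrow> 'e \<Rightarrow> 'e" where
  "local_field M c X x = (let p = param c x in tangent_change (chart_at M p) c p (X p))"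

definition riemannian_manifold ::
    "('a::{t2_space, second_countable_topology}, 'e::euclidean_space) riem \<Rightarrow> bool" where
  "riemannian_manifold M \<longleftrightarrow>
     smooth_atlas (atlas M) \<and>
     (\<forall>p. chart_at M p \<in> atlas M \<and> p \<in> cdom (chart_at M p)) \<and>
     (\<forall>p. bilinear (metric M p) \<and>
          (\<forall>u v. metric M p u v = metric M p v u) \<and>
          (\<forall>u. u \<noteq> 0 \<longrightarrow> metric M p u u > 0)) \<and>
     (\<forall>c\<in>atlas M. \<forall>u v. smooth_on (cimage c) (\<lambda>x. local_metric M c x u v))"

definition smooth_fun ::
    "('a, 'e::euclidean_space) riem \<Rightarrow> ('a \<Rightarrow> 'f::real_normed_vector) \<Rightarrow> bool" where
  "smooth_fun M f \<longleftrightarrow> (\<forall>c\<in>atlas M. smooth_on (cimage c) (f \<circ> param c))"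


section \<open>Gradient, Levi-Civita connection and divergence\<close>

definition differential ::
    "('a, 'e::euclidean_space) riem \<Rightarrow> ('a \<Rightarrow> real) \<Rightarrow> 'a \<Rightarrow> 'e \<Rightarrow> real" where
  "differential M f p =
     (let c = chart_at M p in frechet_derivative (f \<circ> param c) (at (coord c p)))"

definition grad :: "('a, 'e::euclidean_space) riem \<Rightarrow> ('a \<Rightarrow> real) \<Rightarrow> 'a \<Rightarrow> 'e" where
  "grad M f p = (THE w. \<forall>u. metric M p w u = differential M f p u)"

text \<open>In the next three definitions \<open>h\<close> is a Riemannian metric on an open subset of Euclidean space
  and \<open>X, Y, Z\<close> are vector fields there. The Koszul formula gives
  \<open>2 h(\<nabla>\<^sub>X Y, Z) = X h(Y,Z) + Y h(Z,X) - Z h(X,Y) + h([X,Y],Z) - h([X,Z],Y) - h([Y,Z],X)\<close>,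
  both sides of which are tensorial in \<open>X\<close> and \<open>Z\<close>, so that constant fields suffice there.\<close>

definition lie_bracket ::
    "('e::euclidean_space \<Rightarrow> 'e) \<Rightarrow> ('e \<Rightarrow> 'e) \<Rightarrow> 'e \<Rightarrow> 'e" where
  "lie_bracket X Y x = frechet_derivative Y (at x) (X x) - frechet_derivative X (at x) (Y x)"

definition koszul ::
    "('e::euclidean_space \<Rightarrow> 'e \<Rightarrow> 'e \<Rightarrow> real) \<Rightarrow> ('e \<Rightarrow> 'e) \<Rightarrow> ('e \<Rightarrow> 'e) \<Rightarrow> ('e \<Rightarrow> 'e) \<Rightarrow> 'e \<Rightarrow> real"
  where
  "koszul h X Y Z x =
     frechet_derivative (\<lambda>y. h y (Y y) (Z y)) (at x) (X x)
     + frechet_derivative (\<lambda>y. h y (Z y) (X y)) (at x) (Y x)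
     - frechet_derivative (\<lambda>y. h y (X y) (Y y)) (at x) (Z x)
     + h x (lie_bracket X Y x) (Z x)
     - h x (lie_bracket X Z x) (Y x)
     - h x (lie_bracket Y Z x) (X x)"

definition levi_civita ::
    "('e::euclidean_space \<Rightarrow> 'e \<Rightarrow> 'e \<Rightarrow> real) \<Rightarrow> 'e \<Rightarrow> ('e \<Rightarrow> 'e) \<Rightarrow> 'e \<Rightarrow> 'e" where
  "levi_civita h u Y x = (THE w. \<forall>v. 2 * h x w v = koszul h (\<lambda>_. u) Y (\<lambda>_. v) x)"

definition lin_trace :: "('e::euclidean_space \<Rightarrow> 'e) \<Rightarrow> real" where
  "lin_trace L = (\<Sum>b\<in>Basis. L b \<bullet> b)"

text \<open>The divergence of \<open>X\<close> at \<open>p\<close> is the trace of \<open>u \<mapsto> \<nabla>\<^sub>u X\<close>. It is computed in the chart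
  \<open>chart_at M p\<close>; any chart around \<open>p\<close> gives the same value.\<close>

definition divergence :: "('a, 'e::euclidean_space) riem \<Rightarrow> ('a \<Rightarrow> 'e) \<Rightarrow> 'a \<Rightarrow> real" where
  "divergence M X p =
     (let c = chart_at M p
      in lin_trace (\<lambda>u. levi_civita (local_metric M c) u (local_field M c X) (coord c p)))"


section \<open>Complexification and eigenfunctions\<close>

text \<open>\<open>CVec u v\<close> is the complexified tangent vector \<open>u + \<i> v\<close>.\<close>

datatype 'e cvec = CVec (Re_vec: 'e) (Im_vec: 'e)

definition cmetric :: "('a, 'e) riem \<Rightarrow> 'a \<Rightarrow> 'e cvec \<Rightarrow> 'e cvec \<Rightarrow> complex" where
  "cmetric M p Z W = Complex
     (metric M p (Re_vec Z) (Re_vec W) - metric M p (Im_vec Z) (Im_vec W))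
     (metric M p (Re_vec Z) (Im_vec W) + metric M p (Im_vec Z) (Re_vec W))"

definition cgrad :: "('a, 'e::euclidean_space) riem \<Rightarrow> ('a \<Rightarrow> complex) \<Rightarrow> 'a \<Rightarrow> 'e cvec" where
  "cgrad M f p = CVec (grad M (\<lambda>q. Re (f q)) p) (grad M (\<lambda>q. Im (f q)) p)"

definition cdivergence :: "('a, 'e::euclidean_space) riem \<Rightarrow> ('a \<Rightarrow> 'e cvec) \<Rightarrow> 'a \<Rightarrow> complex" where
  "cdivergence M Z p =
     Complex (divergence M (\<lambda>q. Re_vec (Z q)) p) (divergence M (\<lambda>q. Im_vec (Z q)) p)"

definition tension :: "('a, 'e::euclidean_space) riem \<Rightarrow> ('a \<Rightarrow> complex) \<Rightarrow> 'a \<Rightarrow> complex" where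
  "tension M f = cdivergence M (cgrad M f)"

definition conformality ::
    "('a, 'e::euclidean_space) riem \<Rightarrow> ('a \<Rightarrow> complex) \<Rightarrow> ('a \<Rightarrow> complex) \<Rightarrow> 'a \<Rightarrow> complex" where
  "conformality M f h p = cmetric M p (cgrad M f p) (cgrad M h p)"

definition eigenfunction :: "('a, 'e::euclidean_space) riem \<Rightarrow> ('a \<Rightarrow> complex) \<Rightarrow> bool" where
  "eigenfunction M \<phi> \<longleftrightarrow> smooth_fun M \<phi> \<and>
     (\<exists>l \<mu>. (\<forall>p. tension M \<phi> p = l * \<phi> p) \<and>
           (\<forall>p. conformality M \<phi> \<phi> p = \<mu> * (\<phi> p)\<^sup>2))"


section \<open>Riemannian products\<close>

definition prod_chart :: "('a, 'e) chart \<Rightarrow> ('b, 'f) chart \<Rightarrow> ('a \<times> 'b, 'e \<times> 'f) chart" where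
  "prod_chart c d = Chart (cdom c \<times> cdom d) (map_prod (coord c) (coord d))"

definition riem_prod :: "('a, 'e) riem \<Rightarrow> ('b, 'f) riem \<Rightarrow> ('a \<times> 'b, 'e \<times> 'f) riem" where
  "riem_prod M\<^sub>1 M\<^sub>2 =
     \<lparr>atlas = {prod_chart c d |c d. c \<in> atlas M\<^sub>1 \<and> d \<in> atlas M\<^sub>2},
      chart_at = (\<lambda>(p, q). prod_chart (chart_at M\<^sub>1 p) (chart_at M\<^sub>2 q)),
      metric = (\<lambda>(p, q) (u\<^sub>1, u\<^sub>2) (v\<^sub>1, v\<^sub>2). metric M\<^sub>1 p u\<^sub>1 v\<^sub>1 + metric M\<^sub>2 q u\<^sub>2 v\<^sub>2)\<rparr>"


section \<open>The Riemannian product of Riemannian manifolds is a Riemannian manifold\<close>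

lemma Ck_on_cong:
  assumes "open S" "\<And>x. x \<in> S \<Longrightarrow> f x = g x" "Ck_on k S f"
  shows "Ck_on k S g"
  using assms
proof (induction k arbitrary: f g)
  case 0
  then show ?case by (simp cong: continuous_on_cong)
next
  case (Suc k)
  have D: "(g has_derivative frechet_derivative f (at x)) (at x)" if "x \<in> S" for x
  proof -
    have "(f has_derivative frechet_derivative f (at x)) (at x)"
      using Suc.prems(3) that by (simp add: frechet_derivative_works)
    then show ?thesis
      by (rule has_derivative_transform_within_open[OF _ Suc.prems(1) that]) (use Suc.prems in auto)
  qed
  have E: "frechet_derivative g (at x) = frechet_derivative f (at x)" if "x \<in> S" for x
    using frechet_derivative_at[OF D[OF that]] by simp
  show ?case
  proof (simp, intro conjI ballI allI)
    fix x assume "x \<in> S" then show "g differentiable at x"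
      using D differentiable_def by blast
  next
    fix v
    show "Ck_on k S (\<lambda>x. frechet_derivative g (at x) v)"
      by (rule Suc.IH[of "\<lambda>x. frechet_derivative f (at x) v"]) (use Suc.prems E in auto)
  qed
qed

lemma Ck_on_add:
  assumes "open S" "Ck_on k S f" "Ck_on k S g"
  shows "Ck_on k S (\<lambda>x. f x + g x)"
  using assms
proof (induction k arbitrary: f g)
  case 0
  then show ?case by (auto intro: continuous_on_add)
next
  case (Suc k)
  show ?case
  proof (simp, intro conjI ballI allI)
    fix x assume "x \<in> S" then show "(\<lambda>x. f x + g x) differentiable at x"
      using Suc.prems by auto
  next
    fix v
    have "Ck_on k S (\<lambda>x. frechet_derivative f (at x) v + frechet_derivative g (at x) v)"
      using Suc by auto
    then show "Ck_on k S (\<lambda>x. frechet_derivative (\<lambda>x. f x + g x) (at x) v)"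
      by (rule Ck_on_cong[OF Suc.prems(1), rotated])
         (use Suc.prems in \<open>auto simp: frechet_derivative_works
           intro!: fun_cong[OF frechet_derivative_at] has_derivative_add\<close>)
  qed
qed

lemma Ck_on_linear_compose:
  fixes f :: "'e::euclidean_space \<Rightarrow> 'f::real_normed_vector" and P :: "'g::euclidean_space \<Rightarrow> 'e"
  assumes "open S" "open T" "bounded_linear P" "P ` T \<subseteq> S" "Ck_on k S f"
  shows "Ck_on k T (\<lambda>x. f (P x))"
  using assms
proof (induction k arbitrary: f)
  case 0
  then show ?case
    by (auto intro: continuous_on_compose2[of S f T P] linear_continuous_on)
next
  case (Suc k)
  have D: "((\<lambda>x. f (P x)) has_derivative (\<lambda>v. frechet_derivative f (at (P x)) (P v))) (at x)"
    if "x \<in> T" for x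
  proof -
    have "P x \<in> S" using that Suc.prems(4) by auto
    then have "(f has_derivative frechet_derivative f (at (P x))) (at (P x))"
      using Suc.prems(5) by (simp add: frechet_derivative_works)
    from diff_chain_at[OF bounded_linear_imp_has_derivative[OF Suc.prems(3)] this]
    show ?thesis by (simp add: o_def)
  qed
  show ?case
  proof (simp, intro conjI ballI allI)
    fix x assume "x \<in> T" then show "(\<lambda>x. f (P x)) differentiable at x"
      using D differentiable_def by blast
  next
    fix v
    have "Ck_on k T (\<lambda>x. frechet_derivative f (at (P x)) (P v))"
      by (rule Suc.IH[of "\<lambda>x. frechet_derivative f (at x) (P v)"]) (use Suc.prems in auto)
    then show "Ck_on k T (\<lambda>x. frechet_derivative (\<lambda>x. f (P x)) (at x) v)"
      by (rule Ck_on_cong[OF Suc.prems(2), rotated])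
         (simp add: frechet_derivative_at[OF D, symmetric])
  qed
qed

lemma Ck_on_Pair:
  assumes "open S" "Ck_on k S f" "Ck_on k S g"
  shows "Ck_on k S (\<lambda>x. (f x, g x))"
  using assms
proof (induction k arbitrary: f g)
  case 0
  then show ?case by (auto intro: continuous_on_Pair)
next
  case (Suc k)
  have D: "((\<lambda>x. (f x, g x)) has_derivative
      (\<lambda>v. (frechet_derivative f (at x) v, frechet_derivative g (at x) v))) (at x)"
    if "x \<in> S" for x
    using Suc.prems that by (auto intro!: has_derivative_Pair simp: frechet_derivative_works)
  show ?case
  proof (simp, intro conjI ballI allI)
    fix x assume "x \<in> S" then show "(\<lambda>x. (f x, g x)) differentiable at x"
      using D differentiable_def by blast
  next
    fix v
    have "Ck_on k S (\<lambda>x. (frechet_derivative f (at x) v, frechet_derivative g (at x) v))"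
      using Suc by auto
    then show "Ck_on k S (\<lambda>x. frechet_derivative (\<lambda>x. (f x, g x)) (at x) v)"
      by (rule Ck_on_cong[OF Suc.prems(1), rotated])
         (simp add: frechet_derivative_at[OF D, symmetric])
  qed
qed

lemma smooth_on_cong:
  "open S \<Longrightarrow> (\<And>x. x \<in> S \<Longrightarrow> f x = g x) \<Longrightarrow> smooth_on S f \<Longrightarrow> smooth_on S g"
  using Ck_on_cong unfolding smooth_on_def by blast

lemma smooth_on_fst:
  "open S \<Longrightarrow> open T \<Longrightarrow> smooth_on S f \<Longrightarrow> smooth_on (S \<times> T) (\<lambda>z. f (fst z))"
  unfolding smooth_on_def
  by (auto intro!: Ck_on_linear_compose[where P = fst and S = S] bounded_linear_fst open_Times)

lemma smooth_on_snd:
  "open S \<Longrightarrow> open T \<Longrightarrow> smooth_on T f \<Longrightarrow> smooth_on (S \<times> T) (\<lambda>z. f (snd z))"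
  unfolding smooth_on_def
  by (auto intro!: Ck_on_linear_compose[where P = snd and S = T] bounded_linear_snd open_Times)

lemma cdom_prod [simp]: "cdom (prod_chart c d) = cdom c \<times> cdom d"
  by (simp add: prod_chart_def)

lemma coord_prod [simp]: "coord (prod_chart c d) = map_prod (coord c) (coord d)"
  by (simp add: prod_chart_def)

lemma cimage_prod [simp]: "cimage (prod_chart c d) = cimage c \<times> cimage d"
  by (auto simp: cimage_def)

lemma param_coord: "is_chart c \<Longrightarrow> p \<in> cdom c \<Longrightarrow> param c (coord c p) = p"
  by (auto simp: is_chart_def homeomorphism_def)

lemma coord_param: "x \<in> cimage c \<Longrightarrow> coord c (param c x) = x \<and> param c x \<in> cdom c"
  unfolding cimage_def param_def by (simp add: f_inv_into_f inv_into_into)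

lemma is_chart_inj: "is_chart c \<Longrightarrow> inj_on (coord c) (cdom c)"
  by (metis inj_onI param_coord)

lemma param_prod:
  assumes "is_chart c" "is_chart d" "x \<in> cimage c" "y \<in> cimage d"
  shows "param (prod_chart c d) (x, y) = (param c x, param d y)"
proof -
  have i: "inj_on (coord (prod_chart c d)) (cdom (prod_chart c d))"
    using is_chart_inj[OF assms(1)] is_chart_inj[OF assms(2)] by (auto simp: inj_on_def)
  show ?thesis
    unfolding param_def[of "prod_chart c d"]
    by (rule inv_into_f_eq[OF i]) (use assms(3,4) in \<open>auto simp: coord_param\<close>)
qed

lemma is_chart_prod:
  assumes "is_chart c" "is_chart d"
  shows "is_chart (prod_chart c d)"
proof -
  have "homeomorphism (cdom c \<times> cdom d) (cimage c \<times> cimage d) (map_prod (coord c) (coord d))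
      (param (prod_chart c d))"
  proof (rule homeomorphismI)
    show "continuous_on (cdom c \<times> cdom d) (map_prod (coord c) (coord d))"
      unfolding map_prod_def case_prod_beta
      using assms unfolding is_chart_def homeomorphism_def
      by (auto intro!: continuous_intros intro: continuous_on_compose2[where s = "_ \<times> _"])
    have "continuous_on (cimage c \<times> cimage d) (\<lambda>z. (param c (fst z), param d (snd z)))"
      using assms unfolding is_chart_def homeomorphism_def
      by (auto intro!: continuous_intros intro: continuous_on_compose2[where s = "_ \<times> _"])
    then show "continuous_on (cimage c \<times> cimage d) (param (prod_chart c d))"
      by (rule continuous_on_eq) (use assms in \<open>auto simp: param_prod\<close>)
  qed (use assms in \<open>auto simp: param_prod cimage_def param_coord coord_param\<close>)
  then show ?thesis
    using assms by (auto simp: is_chart_def open_Times)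
qed

lemma open_overlap:
  assumes "is_chart c" "is_chart d"
  shows "open (coord c ` (cdom c \<inter> cdom d))"
proof -
  have "openin (top_of_set (cdom c)) (cdom c \<inter> cdom d)"
    using assms by (auto simp: is_chart_def openin_open)
  then have "openin (top_of_set (cimage c)) (coord c ` (cdom c \<inter> cdom d))"
    using assms(1) unfolding is_chart_def
    by (meson homeomorphism_imp_open_map)
  then show ?thesis
    using assms(1) unfolding is_chart_def by (meson openin_open_trans)
qed

lemma transition_prod:
  assumes "is_chart c" "is_chart c'" "is_chart d" "is_chart d'" "x \<in> cimage c" "y \<in> cimage d"
  shows "transition (prod_chart c d) (prod_chart c' d') (x, y) =
    (transition c c' x, transition d d' y)"
  using assms by (simp add: transition_def param_prod)

lemma smooth_atlas_prod:
  assumes A: "smooth_atlas A" and B: "smooth_atlas B"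
  shows "smooth_atlas {prod_chart c d |c d. c \<in> A \<and> d \<in> B}"
  unfolding smooth_atlas_def
proof (intro conjI ballI)
  fix e assume "e \<in> {prod_chart c d |c d. c \<in> A \<and> d \<in> B}"
  then show "is_chart e" using A B by (auto simp: smooth_atlas_def is_chart_prod)
next
  have "\<exists>c\<in>A. p \<in> cdom c" "\<exists>d\<in>B. q \<in> cdom d" for p q
    using A B unfolding smooth_atlas_def by blast+
  then show "(\<Union>c\<in>{prod_chart c d |c d. c \<in> A \<and> d \<in> B}. cdom c) = UNIV"
    by fastforce
next
  fix e e' assume "e \<in> {prod_chart c d |c d. c \<in> A \<and> d \<in> B}"
    "e' \<in> {prod_chart c d |c d. c \<in> A \<and> d \<in> B}"
  then obtain c d c' d' where *: "e = prod_chart c d" "e' = prod_chart c' d'"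
    "c \<in> A" "c' \<in> A" "d \<in> B" "d' \<in> B" by blast
  then have ch: "is_chart c" "is_chart c'" "is_chart d" "is_chart d'"
    using A B by (auto simp: smooth_atlas_def)
  let ?S = "coord c ` (cdom c \<inter> cdom c')" and ?T = "coord d ` (cdom d \<inter> cdom d')"
  have o: "open ?S" "open ?T" using open_overlap ch by auto
  have sm: "smooth_on ?S (transition c c')" "smooth_on ?T (transition d d')"
    using * A B by (auto simp: smooth_atlas_def)
  have "smooth_on (?S \<times> ?T) (\<lambda>z. (transition c c' (fst z), transition d d' (snd z)))"
    using smooth_on_fst[OF o sm(1)] smooth_on_snd[OF o sm(2)] o
    unfolding smooth_on_def by (auto intro!: Ck_on_Pair open_Times)
  then have "smooth_on (?S \<times> ?T) (transition e e')"
    by (rule smooth_on_cong[rotated 2])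
      (use o ch in \<open>auto simp: open_Times * transition_prod cimage_def\<close>)
  moreover have "coord e ` (cdom e \<inter> cdom e') = ?S \<times> ?T"
    unfolding *(1,2) cdom_prod coord_prod Times_Int_Times by (rule map_prod_surj_on) simp_all
  ultimately show "smooth_on (coord e ` (cdom e \<inter> cdom e')) (transition e e')" by simp
qed

lemma smooth_on_differentiable: "smooth_on S f \<Longrightarrow> x \<in> S \<Longrightarrow> f differentiable (at x)"
  using Ck_on.simps(2)[of 0 S f] unfolding smooth_on_def by blast

lemma tangent_change_prod:
  assumes A: "smooth_atlas A" and B: "smooth_atlas B"
    and c: "c \<in> A" "c' \<in> A" "p \<in> cdom c" "p \<in> cdom c'"
    and d: "d \<in> B" "d' \<in> B" "q \<in> cdom d" "q \<in> cdom d'"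
  shows "tangent_change (prod_chart c d) (prod_chart c' d') (p, q) (u, v) =
    (tangent_change c c' p u, tangent_change d d' q v)"
proof -
  let ?S = "coord c ` (cdom c \<inter> cdom c')" and ?T = "coord d ` (cdom d \<inter> cdom d')"
  have ch: "is_chart c" "is_chart c'" "is_chart d" "is_chart d'"
    using A B c d by (auto simp: smooth_atlas_def)
  have o: "open ?S" "open ?T" using open_overlap ch by auto
  have "transition c c' differentiable at (coord c p)" "transition d d' differentiable at (coord d q)"
    using A B c d by (auto simp: smooth_atlas_def intro!: smooth_on_differentiable)
  then have D: "(transition c c' has_derivative tangent_change c c' p) (at (coord c p))"
    "(transition d d' has_derivative tangent_change d d' q) (at (coord d q))"
    by (auto simp: tangent_change_def frechet_derivative_works)
  have "((\<lambda>z. (transition c c' (fst z), transition d d' (snd z))) has_derivative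
     (\<lambda>z. (tangent_change c c' p (fst z), tangent_change d d' q (snd z)))) (at (coord c p, coord d q))"
    using diff_chain_at[of fst fst "(coord c p, coord d q)" "transition c c'" "tangent_change c c' p"]
      diff_chain_at[of snd snd "(coord c p, coord d q)" "transition d d'" "tangent_change d d' q"] D
    by (auto intro!: has_derivative_Pair bounded_linear_imp_has_derivative bounded_linear_fst
       bounded_linear_snd simp: o_def)
  then have "(transition (prod_chart c d) (prod_chart c' d') has_derivative
     (\<lambda>z. (tangent_change c c' p (fst z), tangent_change d d' q (snd z)))) (at (coord c p, coord d q))"
    by (rule has_derivative_transform_within_open[where s = "?S \<times> ?T"])
      (use o ch c d in \<open>auto simp: open_Times transition_prod cimage_def\<close>)
  from frechet_derivative_at[OF this] show ?thesis
    unfolding tangent_change_def[of "prod_chart c d"] by (simp add: fun_eq_iff)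
qed

lemma riem_prod_sel [simp]:
  "atlas (riem_prod M\<^sub>1 M\<^sub>2) = {prod_chart c d |c d. c \<in> atlas M\<^sub>1 \<and> d \<in> atlas M\<^sub>2}"
  "chart_at (riem_prod M\<^sub>1 M\<^sub>2) (p, q) = prod_chart (chart_at M\<^sub>1 p) (chart_at M\<^sub>2 q)"
  "metric (riem_prod M\<^sub>1 M\<^sub>2) (p, q) (u\<^sub>1, u\<^sub>2) (v\<^sub>1, v\<^sub>2) = metric M\<^sub>1 p u\<^sub>1 v\<^sub>1 + metric M\<^sub>2 q u\<^sub>2 v\<^sub>2"
  by (simp_all add: riem_prod_def)

lemma local_metric_prod:
  assumes "riemannian_manifold M\<^sub>1" "riemannian_manifold M\<^sub>2"
    "c \<in> atlas M\<^sub>1" "d \<in> atlas M\<^sub>2" "x \<in> cimage c" "y \<in> cimage d"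
  shows "local_metric (riem_prod M\<^sub>1 M\<^sub>2) (prod_chart c d) (x, y) (u\<^sub>1, u\<^sub>2) (v\<^sub>1, v\<^sub>2) =
    local_metric M\<^sub>1 c x u\<^sub>1 v\<^sub>1 + local_metric M\<^sub>2 d y u\<^sub>2 v\<^sub>2"
proof -
  have A: "smooth_atlas (atlas M\<^sub>1)" "smooth_atlas (atlas M\<^sub>2)"
    using assms by (auto simp: riemannian_manifold_def)
  have "param (prod_chart c d) (x, y) = (param c x, param d y)"
    using A assms by (intro param_prod) (auto simp: smooth_atlas_def)
  moreover have "param c x \<in> cdom c" "param d y \<in> cdom d" using assms by (auto simp: coord_param)
  ultimately show ?thesis
    using assms unfolding local_metric_def Let_def
    by (simp add: tangent_change_prod[OF A] riemannian_manifold_def)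
qed

lemma riemannian_manifold_prod:
  assumes "riemannian_manifold M\<^sub>1" "riemannian_manifold M\<^sub>2"
  shows "riemannian_manifold (riem_prod M\<^sub>1 M\<^sub>2)"
  unfolding riemannian_manifold_def
proof (intro conjI allI ballI impI)
  let ?N = "riem_prod M\<^sub>1 M\<^sub>2"
  have m: "bilinear (metric M\<^sub>1 p)" "bilinear (metric M\<^sub>2 q)"
    "metric M\<^sub>1 p u v = metric M\<^sub>1 p v u" "metric M\<^sub>2 q u' v' = metric M\<^sub>2 q v' u'"
    "u \<noteq> 0 \<Longrightarrow> metric M\<^sub>1 p u u > 0" "u' \<noteq> 0 \<Longrightarrow> metric M\<^sub>2 q u' u' > 0" for p q u v u' v'
    using assms by (auto simp: riemannian_manifold_def)
  show "smooth_atlas (atlas ?N)"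
    using assms smooth_atlas_prod by (auto simp: riemannian_manifold_def)
  fix P :: "'a \<times> 'c"
  obtain p q where P: "P = (p, q)" by fastforce
  show "chart_at ?N P \<in> atlas ?N" "P \<in> cdom (chart_at ?N P)"
    using assms unfolding P riemannian_manifold_def by auto
  show "bilinear (metric ?N P)"
    unfolding P bilinear_def
    by (auto intro!: linearI simp: bilinear_ladd[OF m(1)] bilinear_ladd[OF m(2)] bilinear_radd[OF m(1)]
      bilinear_radd[OF m(2)] bilinear_lmul[OF m(1)] bilinear_lmul[OF m(2)] bilinear_rmul[OF m(1)]
      bilinear_rmul[OF m(2)] algebra_simps)
  show "metric ?N P u v = metric ?N P v u" for u v
    unfolding P by (cases u; cases v) (simp add: m(3)[of p] m(4)[of q])
  show "metric ?N P u u > 0" if "u \<noteq> 0" for u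
  proof (cases u)
    case (Pair u\<^sub>1 u\<^sub>2)
    have "metric M\<^sub>1 p u\<^sub>1 u\<^sub>1 \<ge> 0" "metric M\<^sub>2 q u\<^sub>2 u\<^sub>2 \<ge> 0"
      using m(5)[of u\<^sub>1 p] m(6)[of u\<^sub>2 q] bilinear_lzero[OF m(1)[of p]] bilinear_lzero[OF m(2)[of q]]
      by (metis less_imp_le order_refl)+
    moreover have "u\<^sub>1 \<noteq> 0 \<or> u\<^sub>2 \<noteq> 0" using that Pair by (auto simp: zero_prod_def)
    ultimately show ?thesis using m(5)[of u\<^sub>1 p] m(6)[of u\<^sub>2 q] unfolding P Pair by auto
  qed
next
  fix e u v assume "e \<in> atlas (riem_prod M\<^sub>1 M\<^sub>2)"
  then obtain c d where e: "e = prod_chart c d" "c \<in> atlas M\<^sub>1" "d \<in> atlas M\<^sub>2" by auto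
  have o: "open (cimage c)" "open (cimage d)"
    using assms e by (auto simp: riemannian_manifold_def smooth_atlas_def is_chart_def)
  have "smooth_on (cimage c) (\<lambda>x. local_metric M\<^sub>1 c x (fst u) (fst v))"
    "smooth_on (cimage d) (\<lambda>x. local_metric M\<^sub>2 d x (snd u) (snd v))"
    using assms e by (auto simp: riemannian_manifold_def)
  from smooth_on_fst[OF o this(1)] smooth_on_snd[OF o this(2)]
  have "smooth_on (cimage c \<times> cimage d) (\<lambda>z. local_metric M\<^sub>1 c (fst z) (fst u) (fst v) +
     local_metric M\<^sub>2 d (snd z) (snd u) (snd v))"
    using o unfolding smooth_on_def by (auto intro!: Ck_on_add open_Times)
  then show "smooth_on (cimage e) (\<lambda>x. local_metric (riem_prod M\<^sub>1 M\<^sub>2) e x u v)"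
    unfolding e(1) cimage_prod
    apply (rule smooth_on_cong[rotated 2])
    subgoal using o by (simp add: open_Times)
    subgoal for z
      using local_metric_prod[OF assms e(2,3), of "fst z" "snd z" "fst u" "snd u" "fst v" "snd v"]
      by auto
    done
qed

end

theory Submission
  imports Defs
begin

text \<open>
  For real functions \<open>f\<close> on \<open>M\<^sub>1\<close> and \<open>g\<close> on \<open>M\<^sub>2\<close>, the gradient of \<open>f(p) g(q)\<close> with respect to the
  product metric is \<open>(g(q) \<nabla>f(p), f(p) \<nabla>g(q))\<close> (\<open>grad_prod_mult\<close>). The Christoffel term of a product
  metric splits into those of the factors (\<open>christoffel_prod\<close>), and the derivatives of the factors \<open>g(q)\<close>
  and \<open>f(p)\<close> enter the covariant derivative of this gradient only off the diagonal. Taking the trace gives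
  \<open>\<Delta>(f g) = g \<Delta>f + f \<Delta>g\<close> without a mixed term (\<open>laplacian_prod_mult\<close>). Splitting complex functions into
  real and imaginary parts yields
  \<open>\<tau>(\<psi>) = \<tau>\<^sub>1(\<phi>\<^sub>1) \<phi>\<^sub>2 + \<phi>\<^sub>1 \<tau>\<^sub>2(\<phi>\<^sub>2)\<close> and
  \<open>\<kappa>(\<psi>,\<psi>) = \<kappa>\<^sub>1(\<phi>\<^sub>1,\<phi>\<^sub>1) \<phi>\<^sub>2\<^sup>2 + \<phi>\<^sub>1\<^sup>2 \<kappa>\<^sub>2(\<phi>\<^sub>2,\<phi>\<^sub>2)\<close> for \<open>\<psi> = \<phi>\<^sub>1 \<phi>\<^sub>2\<close>, and the theorem
  follows by substituting the eigenvalue equations.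

  Two facts about the definitions carry this computation. The Koszul formula, evaluated on a differentiable
  field \<open>Y\<close>, gives \<open>\<nabla>\<^sub>u Y = DY(u) + \<Gamma>(u, Y)\<close> (\<open>levi_civita_eq\<close>). For this to apply to gradients
  they must be differentiable: in any chart the gradient represents the differential of the coordinate
  expression of \<open>f\<close> with respect to the local metric (\<open>local_field_grad\<close>), and the solution of such a
  linear system depends differentiably on the point (\<open>differentiable_sharp\<close>).
\<close>

section \<open>Inner products on a Euclidean space\<close>

text \<open>An arbitrary inner product, independent of the standard one on the Euclidean space.\<close>

definition inner_form :: "('e::euclidean_space \<Rightarrow> 'e \<Rightarrow> real) \<Rightarrow> bool" where
  "inner_form B \<longleftrightarrow> bilinear B \<and> (\<forall>u v. B u v = B v u) \<and> (\<forall>u. u \<noteq> 0 \<longrightarrow> B u u > 0)"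

text \<open>The vector representing the functional \<open>l\<close> with respect to \<open>B\<close> (Riesz). Gradients and
  Christoffel vectors are both obtained from it.\<close>

definition sharp :: "('e::euclidean_space \<Rightarrow> 'e \<Rightarrow> real) \<Rightarrow> ('e \<Rightarrow> real) \<Rightarrow> 'e" where
  "sharp B l = (THE w. \<forall>u. B w u = l u)"

lemma linear_real_expand:
  fixes l :: "'e::euclidean_space \<Rightarrow> real"
  assumes "linear l"
  shows "l v = (\<Sum>i\<in>Basis. (v \<bullet> i) * l i)"
  using Linear_Algebra.linear_componentwise[OF assms, of v 1] by simp

lemma inner_form_sym: "inner_form B \<Longrightarrow> B u v = B v u"
  by (auto simp: inner_form_def)

lemma inner_form_linear:
  assumes "inner_form B"
  shows "linear (B u)" and "linear (\<lambda>w. B w v)"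
  using assms by (auto simp: inner_form_def bilinear_def)

lemma inner_form_simps:
  assumes "inner_form B"
  shows "B (u + v) w = B u w + B v w" "B w (u + v) = B w u + B w v"
    "B (u - v) w = B u w - B v w" "B w (u - v) = B w u - B w v"
    "B (r *\<^sub>R u) w = r * B u w" "B w (r *\<^sub>R u) = r * B w u"
    "B 0 w = 0" "B w 0 = 0" "B (- u) w = - B u w" "B w (- u) = - B w u"
  by (simp_all add: linear_add[OF inner_form_linear(1)[OF assms]] linear_add[OF inner_form_linear(2)[OF assms]]
      linear_diff[OF inner_form_linear(1)[OF assms]] linear_diff[OF inner_form_linear(2)[OF assms]]
      linear_scale[OF inner_form_linear(1)[OF assms]] linear_scale[OF inner_form_linear(2)[OF assms]]
      linear_0[OF inner_form_linear(1)[OF assms]] linear_0[OF inner_form_linear(2)[OF assms]]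
      linear_neg[OF inner_form_linear(1)[OF assms]] linear_neg[OF inner_form_linear(2)[OF assms]])

lemma inner_form_nondegenerate:
  assumes "inner_form B" "\<And>u. B w u = B w' u"
  shows "w = w'"
proof (rule ccontr)
  assume "w \<noteq> w'"
  then have "B (w - w') (w - w') > 0"
    using assms(1) by (auto simp: inner_form_def)
  then show False
    using assms(2)[of "w - w'"] by (simp add: inner_form_simps(3)[OF assms(1)])
qed

lemma sharp_eqI:
  assumes "inner_form B" "\<And>u. B w u = l u"
  shows "sharp B l = w"
  unfolding sharp_def
  by (rule the_equality) (use assms inner_form_nondegenerate[OF assms(1)] in auto)

text \<open>The musical map in the opposite direction, with covectors identified with vectors by the standard
  inner product: \<open>lower B w\<close> represents \<open>B w\<close>.\<close>

definition lower :: "('e::euclidean_space \<Rightarrow> 'e \<Rightarrow> real) \<Rightarrow> 'e \<Rightarrow> 'e" where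
  "lower B w = (\<Sum>b\<in>Basis. B w b *\<^sub>R b)"

lemma inner_lower:
  assumes "inner_form B"
  shows "lower B w \<bullet> v = B w v"
  unfolding lower_def linear_real_expand[OF inner_form_linear(1)[OF assms], of w v]
  by (simp add: inner_sum_left inner_commute[of v] mult.commute)

lemma sharp_works:
  fixes B :: "'e::euclidean_space \<Rightarrow> 'e \<Rightarrow> real"
  assumes B: "inner_form B" and l: "linear l"
  shows "B (sharp B l) u = l u"
proof -
  have "linear (lower B)"
    by (rule linearI)
      (simp_all add: lower_def inner_form_simps[OF B] scaleR_left_distrib sum.distrib scaleR_sum_right)
  moreover have "inj (lower B)"
    using inner_form_nondegenerate[OF B] inner_lower[OF B] by (metis injI)
  ultimately have "surj (lower B)"
    by (rule linear_injective_imp_surjective) simp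
  then obtain w where w: "lower B w = (\<Sum>b\<in>Basis. l b *\<^sub>R b)"
    by (metis surjD)
  have "B w v = l v" for v
    unfolding inner_lower[OF B, symmetric] w linear_real_expand[OF l, of v]
    by (simp add: inner_sum_left inner_commute[of v] mult.commute)
  then show ?thesis
    using sharp_eqI[OF B, of w l] by simp
qed

section \<open>Metrics on open subsets\<close>

text \<open>\<open>metric_deriv h x a b u\<close> is the derivative at \<open>x\<close> in direction \<open>u\<close> of the metric coefficient
  \<open>y \<mapsto> h y a b\<close>.\<close>

definition metric_deriv ::
    "('e::euclidean_space \<Rightarrow> 'e \<Rightarrow> 'e \<Rightarrow> real) \<Rightarrow> 'e \<Rightarrow> 'e \<Rightarrow> 'e \<Rightarrow> 'e \<Rightarrow> real" where
  "metric_deriv h x a b = frechet_derivative (\<lambda>y. h y a b) (at x)"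

text \<open>The covariant derivative \<open>\<nabla>\<^sub>u w\<close> of the constant field \<open>w\<close>, that is
  \<open>\<Gamma>\<^sup>k\<^sub>i\<^sub>j u\<^sup>i w\<^sup>j\<close>, as a vector.\<close>

definition christoffel ::
    "('e::euclidean_space \<Rightarrow> 'e \<Rightarrow> 'e \<Rightarrow> real) \<Rightarrow> 'e \<Rightarrow> 'e \<Rightarrow> 'e \<Rightarrow> 'e" where
  "christoffel h x u w = sharp (h x)
     (\<lambda>v. (metric_deriv h x w v u + metric_deriv h x v u w - metric_deriv h x w u v) / 2)"

text \<open>A differentiable metric on an open subset \<open>S\<close>; nothing is required of \<open>h\<close> outside \<open>S\<close>.\<close>

locale metric_on =
  fixes S :: "'e::euclidean_space set" and h :: "'e \<Rightarrow> 'e \<Rightarrow> 'e \<Rightarrow> real"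
  assumes open_S: "open S"
    and inner_form: "\<And>x. x \<in> S \<Longrightarrow> inner_form (h x)"
    and differentiable: "\<And>x u v. x \<in> S \<Longrightarrow> (\<lambda>y. h y u v) differentiable (at x)"
begin

lemma metric_deriv_works:
  "x \<in> S \<Longrightarrow> ((\<lambda>y. h y a b) has_derivative metric_deriv h x a b) (at x)"
  unfolding metric_deriv_def using differentiable frechet_derivative_works by blast

text \<open>Only the values of the coefficient on \<open>S\<close> matter, so any function agreeing with it there computes its
  derivative.\<close>

lemma metric_derivI:
  assumes "x \<in> S" "(f has_derivative D) (at x)" "\<And>y. y \<in> S \<Longrightarrow> f y = h y a b"
  shows "metric_deriv h x a b = D"
proof -
  have "((\<lambda>y. h y a b) has_derivative D) (at x)"
    by (rule has_derivative_transform_within_open[OF assms(2) open_S assms(1)]) (use assms in auto)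
  then show ?thesis
    using has_derivative_unique metric_deriv_works[OF assms(1)] by blast
qed

lemma metric_deriv_sym: "x \<in> S \<Longrightarrow> metric_deriv h x a b = metric_deriv h x b a"
  by (rule metric_derivI[OF _ metric_deriv_works]) (auto intro: inner_form_sym inner_form)

lemma metric_deriv_linear:
  assumes x: "x \<in> S"
  shows "linear (metric_deriv h x a b)" "linear (\<lambda>b. metric_deriv h x a b u)"
    "linear (\<lambda>a. metric_deriv h x a b u)"
proof -
  show "linear (metric_deriv h x a b)"
    using metric_deriv_works[OF x] has_derivative_linear by blast
  have add: "metric_deriv h x a (b + c) = (\<lambda>u. metric_deriv h x a b u + metric_deriv h x a c u)" for a b c
    by (rule metric_derivI[OF x has_derivative_add[OF metric_deriv_works[OF x] metric_deriv_works[OF x]]])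
      (simp add: inner_form_simps inner_form)
  have scale: "metric_deriv h x a (r *\<^sub>R b) = (\<lambda>u. r * metric_deriv h x a b u)" for a b r
    by (rule metric_derivI[OF x has_derivative_mult_right[OF metric_deriv_works[OF x]]])
      (simp add: inner_form_simps inner_form)
  show lin: "linear (\<lambda>b. metric_deriv h x a b u)" for a
    by (rule linearI) (simp_all add: add scale)
  show "linear (\<lambda>a. metric_deriv h x a b u)"
    using lin[of b] by (simp add: metric_deriv_sym[OF x, of b])
qed

lemma has_derivative_metric:
  assumes x: "x \<in> S" and Y: "(Y has_derivative Y') (at x)"
  shows "((\<lambda>y. h y (Y y) v) has_derivative (\<lambda>u. metric_deriv h x (Y x) v u + h x (Y' u) v)) (at x)"
proof -
  have "((\<lambda>y. \<Sum>i\<in>Basis. (Y y \<bullet> i) * h y i v) has_derivative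
      (\<lambda>u. \<Sum>i\<in>Basis. (Y x \<bullet> i) * metric_deriv h x i v u + (Y' u \<bullet> i) * h x i v)) (at x)"
    by (intro has_derivative_sum has_derivative_mult metric_deriv_works[OF x]
        has_derivative_inner_left[OF Y])
  moreover have "(\<Sum>i\<in>Basis. (Y x \<bullet> i) * metric_deriv h x i v u + (Y' u \<bullet> i) * h x i v) =
      metric_deriv h x (Y x) v u + h x (Y' u) v" for u
    unfolding sum.distrib
    using linear_real_expand[OF metric_deriv_linear(3)[OF x]]
      linear_real_expand[OF inner_form_linear(2)[OF inner_form[OF x]]] by metis
  ultimately have "((\<lambda>y. \<Sum>i\<in>Basis. (Y y \<bullet> i) * h y i v) has_derivative
      (\<lambda>u. metric_deriv h x (Y x) v u + h x (Y' u) v)) (at x)" by simp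
  then show ?thesis
    by (rule has_derivative_transform_within_open[OF _ open_S x])
      (simp add: linear_real_expand[OF inner_form_linear(2)[OF inner_form], symmetric])
qed

lemma christoffel_works:
  assumes x: "x \<in> S"
  shows "2 * h x (christoffel h x u w) v =
    metric_deriv h x w v u + metric_deriv h x v u w - metric_deriv h x w u v"
proof -
  note [simp] = linear_add[OF metric_deriv_linear(1)[OF x]] linear_add[OF metric_deriv_linear(2)[OF x]]
    linear_add[OF metric_deriv_linear(3)[OF x]] linear_scale[OF metric_deriv_linear(1)[OF x]]
    linear_scale[OF metric_deriv_linear(2)[OF x]] linear_scale[OF metric_deriv_linear(3)[OF x]]
  have "linear (\<lambda>v. (metric_deriv h x w v u + metric_deriv h x v u w - metric_deriv h x w u v) / 2)"
    by (rule linearI) (simp_all add: algebra_simps add_divide_distrib diff_divide_distrib)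
  from sharp_works[OF inner_form[OF x] this, of v] show ?thesis
    unfolding christoffel_def by simp
qed

lemma christoffel_eqI:
  assumes "x \<in> S" "\<And>v. 2 * h x z v =
    metric_deriv h x w v u + metric_deriv h x v u w - metric_deriv h x w u v"
  shows "christoffel h x u w = z"
proof (rule inner_form_nondegenerate[OF inner_form[OF assms(1)]])
  fix v show "h x (christoffel h x u w) v = h x z v"
    using christoffel_works[OF assms(1), of u w v] assms(2)[of v] by simp
qed

lemma linear_christoffel:
  assumes x: "x \<in> S"
  shows "linear (christoffel h x u)"
proof (rule linearI)
  show "christoffel h x u (v + w) = christoffel h x u v + christoffel h x u w" for v w
    by (rule christoffel_eqI[OF x])
      (simp add: inner_form_simps[OF inner_form[OF x]] distrib_left christoffel_works[OF x]
        linear_add[OF metric_deriv_linear(1)[OF x]] linear_add[OF metric_deriv_linear(3)[OF x]])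
  show "christoffel h x u (r *\<^sub>R w) = r *\<^sub>R christoffel h x u w" for r w
    by (rule christoffel_eqI[OF x])
      (simp add: inner_form_simps[OF inner_form[OF x]] mult.left_commute[of 2] christoffel_works[OF x]
        linear_scale[OF metric_deriv_linear(1)[OF x]] linear_scale[OF metric_deriv_linear(3)[OF x]]
        distrib_left right_diff_distrib)
qed

text \<open>The coordinate formula for the covariant derivative. Differentiability of \<open>Y\<close> is essential, since
  the Koszul expression contains derivatives of \<open>Y\<close> and of \<open>h(Y, v)\<close>.\<close>

lemma levi_civita_eq:
  assumes x: "x \<in> S" and Y: "(Y has_derivative Y') (at x)"
  shows "levi_civita h u Y x = Y' u + christoffel h x u (Y x)"
proof -
  note B = inner_form[OF x]
  have Y': "frechet_derivative Y (at x) = Y'"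
    using frechet_derivative_at[OF Y] by simp
  have 1: "frechet_derivative (\<lambda>y. h y (Y y) v) (at x) =
      (\<lambda>u. metric_deriv h x (Y x) v u + h x (Y' u) v)" for v
    using frechet_derivative_at[OF has_derivative_metric[OF x Y, of v]] by simp
  have "((\<lambda>y. h y v (Y y)) has_derivative (\<lambda>u. metric_deriv h x (Y x) v u + h x (Y' u) v)) (at x)" for v
    by (rule has_derivative_transform_within_open[OF has_derivative_metric[OF x Y, of v] open_S x])
      (auto intro: inner_form_sym inner_form)
  then have 2: "frechet_derivative (\<lambda>y. h y v (Y y)) (at x) =
      (\<lambda>u. metric_deriv h x (Y x) v u + h x (Y' u) v)" for v
    using frechet_derivative_at by metis
  \<comment> \<open>The terms with \<open>Y' v\<close> cancel, while \<open>Y' u\<close> occurs twice: once from differentiating \<open>h(Y, v)\<close>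
    and once from the bracket of \<open>u\<close> and \<open>Y\<close>.\<close>
  have K: "koszul h (\<lambda>_. u) Y (\<lambda>_. v) x = 2 * h x (Y' u + christoffel h x u (Y x)) v" for v
    unfolding koszul_def lie_bracket_def Y' 1 2 inner_form_simps(1)[OF B] distrib_left
      christoffel_works[OF x] metric_deriv_def[of h x, symmetric]
    by (simp add: inner_form_simps[OF B])
  show ?thesis
    unfolding levi_civita_def K
    by (rule the_equality) (auto intro: inner_form_nondegenerate[OF B])
qed

text \<open>Gradients are differentiable because solving \<open>h y w = l y\<close> for \<open>w\<close> depends differentiably on
  \<open>y\<close>. Instead of inverting Gram matrices, the inverse function theorem is applied to
  \<open>\<Phi> (y, w) = (y, lower (h y) w)\<close>, whose left inverse \<open>\<Psi>\<close> is known explicitly; it needs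
  differentiability of \<open>\<Phi>\<close> only.\<close>

lemma differentiable_sharp:
  assumes x: "x \<in> S" and l: "\<And>y. y \<in> S \<Longrightarrow> linear (l y)"
    and dl: "\<And>v. (\<lambda>y. l y v) differentiable (at x)"
  shows "(\<lambda>y. sharp (h y) (l y)) differentiable (at x)"
proof -
  \<comment> \<open>\<open>lower (h y) w\<close> is expanded in coordinates, so that only the coefficients \<open>h y i b\<close>, which are
    differentiable, depend on \<open>y\<close>.\<close>
  define \<Phi> where "\<Phi> = (\<lambda>(y, w). (y, \<Sum>b\<in>Basis. (\<Sum>i\<in>Basis. (w \<bullet> i) * h y i b) *\<^sub>R b))"
  define \<Psi> where "\<Psi> = (\<lambda>(y, z). (y, sharp (h y) (\<lambda>v. z \<bullet> v)))"
  define G where "G y = (y, \<Sum>b\<in>Basis. l y b *\<^sub>R b)" for y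
  define w where "w = sharp (h x) (l x)"
  have \<Phi>: "\<Phi> (y, w) = (y, lower (h y) w)" if "y \<in> S" for y w
    unfolding \<Phi>_def lower_def
    by (simp add: linear_real_expand[OF inner_form_linear(2)[OF inner_form[OF that]], symmetric])
  have \<Psi>\<Phi>: "\<Psi> (\<Phi> z) = z" if "z \<in> S \<times> UNIV" for z
    using that unfolding \<Psi>_def
    by (auto simp: \<Phi> inner_lower inner_form intro!: sharp_eqI)
  have D\<Phi>: "(\<Phi> has_derivative (\<lambda>v. (fst v, \<Sum>b\<in>Basis. (\<Sum>i\<in>Basis.
      (snd z \<bullet> i) * metric_deriv h (fst z) i b (fst v) + (snd v \<bullet> i) * h (fst z) i b) *\<^sub>R b))) (at z)"
    if "z \<in> S \<times> UNIV" for z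
  proof -
    have "((\<lambda>z. h (fst z) i b) has_derivative (\<lambda>v. metric_deriv h (fst z) i b (fst v))) (at z)" for i b
      using diff_chain_at[OF bounded_linear_imp_has_derivative[OF bounded_linear_fst]
          metric_deriv_works, of z i b] that
      by (auto simp: o_def)
    then show ?thesis
      unfolding \<Phi>_def case_prod_beta
      by (intro has_derivative_Pair has_derivative_sum has_derivative_scaleR_left has_derivative_mult
          has_derivative_inner_left has_derivative_fst has_derivative_snd has_derivative_ident)
  qed
  \<comment> \<open>\<open>K v\<close> is the derivative of \<open>y \<mapsto> lower (h y) w\<close> at \<open>x\<close> in direction \<open>v\<close>. The derivative of
    \<open>\<Phi>\<close> at \<open>(x, w)\<close> is \<open>(v, t) \<mapsto> (v, K v + lower (h x) t)\<close>, a block triangular map.\<close>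
  define K where "K v = (\<Sum>b\<in>Basis. (\<Sum>i\<in>Basis. (w \<bullet> i) * metric_deriv h x i b v) *\<^sub>R b)" for v
  have "(\<Psi> has_derivative (\<lambda>(v, s). (v, sharp (h x) (\<lambda>r. (s - K v) \<bullet> r)))) (at (\<Phi> (x, w)))"
  proof (rule has_derivative_inverse_strong[OF _ _ _ \<Psi>\<Phi> D\<Phi>])
    show "open (S \<times> UNIV)" using open_S by (simp add: open_Times)
    show "continuous_on (S \<times> UNIV) \<Phi>"
      by (intro continuous_at_imp_continuous_on ballI has_derivative_continuous[OF D\<Phi>])
    have *: "(\<Sum>b\<in>Basis. (\<Sum>i\<in>Basis. (w \<bullet> i) * metric_deriv h x i b v + (t \<bullet> i) * h x i b) *\<^sub>R b) =
        K v + lower (h x) t" for v t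
      unfolding K_def lower_def
      by (simp add: sum.distrib scaleR_left_distrib
          linear_real_expand[OF inner_form_linear(2)[OF inner_form[OF x]], symmetric])
    have **: "lower (h x) (sharp (h x) (\<lambda>r. s \<bullet> r)) = s" for s
      by (rule euclidean_eqI)
        (simp add: inner_lower[OF inner_form[OF x]] sharp_works[OF inner_form[OF x]]
          bounded_linear.linear[OF bounded_linear_inner_right])
    show "(\<lambda>v. (fst v, \<Sum>b\<in>Basis. (\<Sum>i\<in>Basis.
      (snd (x, w) \<bullet> i) * metric_deriv h (fst (x, w)) i b (fst v) + (snd v \<bullet> i) * h (fst (x, w)) i b) *\<^sub>R b)) \<circ>
      (\<lambda>(v, s). (v, sharp (h x) (\<lambda>r. (s - K v) \<bullet> r))) = id"
      by (auto simp: fun_eq_iff * **)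
  qed (use x in auto)
  moreover have "\<Phi> (x, w) = G x"
    unfolding \<Phi>[OF x] G_def lower_def w_def by (simp add: sharp_works[OF inner_form[OF x] l[OF x]])
  ultimately have "\<Psi> differentiable (at (G x))"
    by (auto simp: differentiable_def)
  moreover have "G differentiable (at x)"
  proof -
    have "((\<lambda>y. l y b) has_derivative frechet_derivative (\<lambda>y. l y b) (at x)) (at x)" for b
      using dl frechet_derivative_works by blast
    then have "(G has_derivative
        (\<lambda>v. (v, \<Sum>b\<in>Basis. frechet_derivative (\<lambda>y. l y b) (at x) v *\<^sub>R b))) (at x)"
      unfolding G_def
      by (intro has_derivative_Pair has_derivative_sum has_derivative_scaleR_left has_derivative_ident)
    then show ?thesis by (auto simp: differentiable_def)
  qed
  ultimately have "(\<Psi> \<circ> G) differentiable (at x)"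
    by (rule differentiable_chain_at[rotated])
  then obtain D where "((\<Psi> \<circ> G) has_derivative D) (at x)"
    by (auto simp: differentiable_def)
  then have "((\<lambda>y. snd ((\<Psi> \<circ> G) y)) has_derivative (\<lambda>v. snd (D v))) (at x)"
    by (rule has_derivative_snd)
  moreover have "snd ((\<Psi> \<circ> G) y) = sharp (h y) (l y)" if "y \<in> S" for y
  proof -
    have "(\<Sum>b\<in>Basis. l y b *\<^sub>R b) \<bullet> v = l y v" for v
      unfolding linear_real_expand[OF l[OF that], of v]
      by (simp add: inner_sum_left inner_commute[of v] mult.commute)
    then have "(\<lambda>v. (\<Sum>b\<in>Basis. l y b *\<^sub>R b) \<bullet> v) = l y" by (rule ext)
    then show ?thesis by (simp add: \<Psi>_def G_def)
  qed
  ultimately have "((\<lambda>y. sharp (h y) (l y)) has_derivative (\<lambda>v. snd (D v))) (at x)"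
    by (rule has_derivative_transform_within_open[OF _ open_S x])
  then show ?thesis by (auto simp: differentiable_def)
qed

end

section \<open>Coordinate expressions of gradient and divergence\<close>

lemma has_derivative_transition:
  assumes "smooth_atlas A" "c \<in> A" "d \<in> A" "p \<in> cdom c" "p \<in> cdom d"
  shows "(transition c d has_derivative tangent_change c d p) (at (coord c p))"
proof -
  have "transition c d differentiable (at (coord c p))"
    using assms by (auto simp: smooth_atlas_def intro!: smooth_on_differentiable)
  then show ?thesis
    by (simp add: tangent_change_def frechet_derivative_works)
qed

lemma has_derivative_change_chart:
  assumes "smooth_atlas A" "c \<in> A" "d \<in> A" "p \<in> cdom c" "p \<in> cdom d"
    and D: "((f \<circ> param d) has_derivative D) (at (coord d p))"
  shows "((f \<circ> param c) has_derivative (\<lambda>u. D (tangent_change c d p u))) (at (coord c p))"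
proof -
  have ch: "is_chart c" "is_chart d" using assms by (auto simp: smooth_atlas_def)
  have "((f \<circ> param d) \<circ> transition c d has_derivative D \<circ> tangent_change c d p) (at (coord c p))"
    by (rule diff_chain_at[OF has_derivative_transition[OF assms(1-5)]])
      (use D ch assms in \<open>simp add: transition_def param_coord\<close>)
  then have "((f \<circ> param c) has_derivative D \<circ> tangent_change c d p) (at (coord c p))"
    by (rule has_derivative_transform_within_open[OF _ open_overlap[OF ch]])
      (use assms ch in \<open>auto simp: transition_def param_coord\<close>)
  then show ?thesis by (simp add: o_def)
qed

lemma linear_tangent_change:
  assumes "smooth_atlas A" "c \<in> A" "d \<in> A" "p \<in> cdom c" "p \<in> cdom d"
  shows "linear (tangent_change c d p)"
  using has_derivative_transition[OF assms] has_derivative_linear by blast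

text \<open>The chain rule for coordinate changes, applied to the coordinate map of \<open>c\<close> itself, which becomes the
  identity when it is read in \<open>c\<close>.\<close>

lemma tangent_change_inverse:
  assumes "smooth_atlas A" "c \<in> A" "d \<in> A" "p \<in> cdom c" "p \<in> cdom d"
  shows "tangent_change d c p (tangent_change c d p u) = u"
proof -
  have c: "is_chart c" using assms by (auto simp: smooth_atlas_def)
  have "((coord c \<circ> param c) has_derivative (\<lambda>u. tangent_change d c p (tangent_change c d p u)))
      (at (coord c p))"
    by (rule has_derivative_change_chart[OF assms])
      (use has_derivative_transition[OF assms(1,3,2,5,4)] in \<open>simp add: transition_def\<close>)
  moreover have "((coord c \<circ> param c) has_derivative (\<lambda>u. u)) (at (coord c p))"
    by (rule has_derivative_transform_within_open[OF has_derivative_ident, of "cimage c"])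
      (use c assms in \<open>auto simp: is_chart_def coord_param cimage_def[symmetric]\<close>,
        auto simp: cimage_def)
  ultimately show ?thesis
    using has_derivative_unique by metis
qed

lemma riemannian_manifoldD:
  assumes "riemannian_manifold M"
  shows "smooth_atlas (atlas M)" "chart_at M p \<in> atlas M" "p \<in> cdom (chart_at M p)"
    "inner_form (metric M p)" "c \<in> atlas M \<Longrightarrow> is_chart c"
    "c \<in> atlas M \<Longrightarrow> open (cimage c)"
  using assms by (auto simp: riemannian_manifold_def inner_form_def smooth_atlas_def is_chart_def)

lemma coord_in_cimage: "p \<in> cdom c \<Longrightarrow> coord c p \<in> cimage c"
  by (simp add: cimage_def)

lemma cimage_cases:
  assumes "x \<in> cimage c"
  obtains p where "p \<in> cdom c" "x = coord c p"
  using assms by (auto simp: cimage_def)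

lemma metric_on_local_metric:
  assumes M: "riemannian_manifold M" and c: "c \<in> atlas M"
  shows "metric_on (cimage c) (local_metric M c)"
proof
  note R = riemannian_manifoldD[OF M]
  show "open (cimage c)" by (rule R(6)[OF c])
  show "(\<lambda>y. local_metric M c y u v) differentiable (at x)" if "x \<in> cimage c" for x u v
    by (rule smooth_on_differentiable[OF _ that]) (use M c in \<open>simp add: riemannian_manifold_def\<close>)
  show "inner_form (local_metric M c x)" if x: "x \<in> cimage c" for x
  proof -
    obtain p where p: "p \<in> cdom c" "x = coord c p" using x by (rule cimage_cases)
    define T where "T = tangent_change c (chart_at M p) p"
    have lm: "local_metric M c x u v = metric M p (T u) (T v)" for u v
      using R(5)[OF c] p by (simp add: local_metric_def T_def param_coord Let_def)
    have T: "linear T"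
      unfolding T_def by (rule linear_tangent_change[OF R(1) c R(2) p(1) R(3)])
    have "T u \<noteq> 0" if "u \<noteq> 0" for u
    proof
      assume "T u = 0"
      then have "T u = T 0" using linear_0[OF T] by simp
      then have "u = 0"
        using tangent_change_inverse[OF R(1) c R(2) p(1) R(3)] unfolding T_def by metis
      then show False using that by simp
    qed
    then show ?thesis
      unfolding inner_form_def bilinear_def lm
      using R(4)[of p] inner_form_sym[OF R(4)[of p]]
      by (auto intro!: linearI simp: inner_form_simps[OF R(4)] linear_add[OF T] linear_scale[OF T]
          inner_form_def)
  qed
qed

lemma smooth_fun_differentiable:
  assumes "smooth_fun M f" "c \<in> atlas M" "x \<in> cimage c"
  shows "(f \<circ> param c) differentiable (at x)"
  by (rule smooth_on_differentiable[OF _ assms(3)]) (use assms in \<open>simp add: smooth_fun_def\<close>)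

lemma smooth_on_frechet_derivative_differentiable:
  assumes "smooth_on S f" "x \<in> S"
  shows "(\<lambda>y. frechet_derivative f (at y) v) differentiable (at x)"
proof -
  have "Ck_on (Suc (Suc 0)) S f" using assms(1) by (simp only: smooth_on_def)
  then show ?thesis using assms(2) unfolding Ck_on.simps(2) by blast
qed

lemma has_derivative_differential:
  assumes "riemannian_manifold M" "smooth_fun M f"
  shows "((f \<circ> param (chart_at M p)) has_derivative differential M f p)
    (at (coord (chart_at M p) p))"
  using smooth_fun_differentiable[OF assms(2) riemannian_manifoldD(2)[OF assms(1)]
      coord_in_cimage[OF riemannian_manifoldD(3)[OF assms(1)]]]
  unfolding differential_def Let_def frechet_derivative_works .

lemma grad_eqI:
  assumes "riemannian_manifold M"
    and "((f \<circ> param (chart_at M p)) has_derivative D) (at (coord (chart_at M p) p))"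
    and "\<And>u. metric M p w u = D u"
  shows "grad M f p = w"
proof -
  have "differential M f p = D"
    using frechet_derivative_at[OF assms(2)] by (simp add: differential_def Let_def)
  then show ?thesis
    using sharp_eqI[OF riemannian_manifoldD(4)[OF assms(1)] assms(3)]
    by (simp add: grad_def sharp_def)
qed

lemma metric_grad:
  assumes "riemannian_manifold M" "smooth_fun M f"
  shows "metric M p (grad M f p) u = differential M f p u"
  using sharp_works[OF riemannian_manifoldD(4)[OF assms(1)]
      has_derivative_linear[OF has_derivative_differential[OF assms]], of p p u]
  by (simp add: grad_def sharp_def)

lemma local_field_eq:
  assumes "is_chart c" "p \<in> cdom c"
  shows "local_field M c X (coord c p) = tangent_change (chart_at M p) c p (X p)"
  using assms by (simp add: local_field_def param_coord)

text \<open>In every chart the gradient is the gradient of the coordinate expression of \<open>f\<close> with respect to the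
  local metric. The distinguished charts, which may vary discontinuously from point to point, drop out.\<close>

lemma local_field_grad:
  assumes M: "riemannian_manifold M" and f: "smooth_fun M f" and c: "c \<in> atlas M"
    and x: "x \<in> cimage c"
  shows "local_field M c (grad M f) x =
    sharp (local_metric M c x) (frechet_derivative (f \<circ> param c) (at x))"
proof -
  note R = riemannian_manifoldD[OF M]
  obtain p where p: "p \<in> cdom c" "x = coord c p" using x by (rule cimage_cases)
  let ?d = "chart_at M p"
  have "((f \<circ> param c) has_derivative (\<lambda>u. differential M f p (tangent_change c ?d p u))) (at x)"
    unfolding p(2)
    by (rule has_derivative_change_chart[OF R(1) c R(2) p(1) R(3) has_derivative_differential[OF M f]])
  then have D: "frechet_derivative (f \<circ> param c) (at x) =
      (\<lambda>u. differential M f p (tangent_change c ?d p u))"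
    using frechet_derivative_at by metis
  show ?thesis
    unfolding p(2) D[unfolded p(2)] local_field_eq[OF R(5)[OF c] p(1)]
    by (rule sharp_eqI[OF metric_on.inner_form[OF metric_on_local_metric[OF M c] coord_in_cimage[OF p(1)]],
          symmetric])
      (simp add: local_metric_def param_coord[OF R(5)[OF c] p(1)] metric_grad[OF M f]
        tangent_change_inverse[OF R(1) R(2) c R(3) p(1)])
qed

text \<open>Vector fields whose coordinate expressions in all charts of the atlas are differentiable. Without this the
  derivatives in the divergence have no meaning.\<close>

definition differentiable_field :: "('a, 'e::euclidean_space) riem \<Rightarrow> ('a \<Rightarrow> 'e) \<Rightarrow> bool" where
  "differentiable_field M X \<longleftrightarrow>
     (\<forall>c\<in>atlas M. \<forall>x\<in>cimage c. local_field M c X differentiable (at x))"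

lemma differentiable_field_grad:
  assumes M: "riemannian_manifold M" and f: "smooth_fun M f"
  shows "differentiable_field M (grad M f)"
  unfolding differentiable_field_def
proof (intro ballI)
  fix c x assume c: "c \<in> atlas M" and x: "x \<in> cimage c"
  interpret metric_on "cimage c" "local_metric M c" by (rule metric_on_local_metric[OF M c])
  have sm: "smooth_on (cimage c) (f \<circ> param c)" using f c by (auto simp: smooth_fun_def)
  have "linear (frechet_derivative (f \<circ> param c) (at y))" if "y \<in> cimage c" for y
    using smooth_on_differentiable[OF sm that] linear_frechet_derivative by blast
  from differentiable_sharp[OF x this smooth_on_frechet_derivative_differentiable[OF sm x]]
  obtain D where "((\<lambda>y. sharp (local_metric M c y) (frechet_derivative (f \<circ> param c) (at y)))
      has_derivative D) (at x)"
    by (auto simp: differentiable_def)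
  then have "(local_field M c (grad M f) has_derivative D) (at x)"
    by (rule has_derivative_transform_within_open[OF _ open_S x])
      (simp add: local_field_grad[OF M f c])
  then show "local_field M c (grad M f) differentiable (at x)"
    by (auto simp: differentiable_def)
qed

lemma lin_trace_add: "lin_trace (\<lambda>u. f u + g u) = lin_trace f + lin_trace g"
  by (simp add: lin_trace_def inner_add_left sum.distrib)

lemma lin_trace_scaleR: "lin_trace (\<lambda>u. a *\<^sub>R f u) = a * lin_trace f"
  by (simp add: lin_trace_def sum_distrib_left)

text \<open>The divergence splits into the trace of the coordinate derivative and the trace of the Christoffel
  term.\<close>

lemma divergence_eq:
  fixes M :: "('a::{t2_space, second_countable_topology}, 'e::euclidean_space) riem"
  assumes M: "riemannian_manifold M" and c: "c = chart_at M p"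
    and D: "(local_field M c X has_derivative D) (at (coord c p))"
  shows "divergence M X p = lin_trace D +
    lin_trace (\<lambda>u. christoffel (local_metric M c) (coord c p) u (local_field M c X (coord c p)))"
proof -
  note R = riemannian_manifoldD[OF M]
  have "c \<in> atlas M" "coord c p \<in> cimage c" using R(2,3) c by (simp_all add: coord_in_cimage)
  then show ?thesis
    using metric_on.levi_civita_eq[OF metric_on_local_metric[OF M], OF _ _ D]
    by (simp add: divergence_def c[symmetric] lin_trace_add)
qed

lemma has_derivative_local_field:
  assumes "riemannian_manifold M" "differentiable_field M X" "c \<in> atlas M" "x \<in> cimage c"
  shows "(local_field M c X has_derivative frechet_derivative (local_field M c X) (at x)) (at x)"
  using assms by (simp add: differentiable_field_def flip: frechet_derivative_works)

lemma divergence_lincomb: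
  assumes M: "riemannian_manifold M" and X: "differentiable_field M X" and Y: "differentiable_field M Y"
  shows "divergence M (\<lambda>q. X q + a *\<^sub>R Y q) p = divergence M X p + a * divergence M Y p"
proof -
  note R = riemannian_manifoldD[OF M]
  define c where "c = chart_at M p"
  define x where "x = coord c p"
  have c: "c \<in> atlas M" and x: "x \<in> cimage c"
    using R(2,3) by (simp_all add: c_def x_def coord_in_cimage)
  interpret metric_on "cimage c" "local_metric M c" by (rule metric_on_local_metric[OF M c])
  note DX = has_derivative_local_field[OF M X c x] and DY = has_derivative_local_field[OF M Y c x]
  have L: "local_field M c (\<lambda>q. X q + a *\<^sub>R Y q) y = local_field M c X y + a *\<^sub>R local_field M c Y y"
    if y: "y \<in> cimage c" for y
  proof -
    obtain q where q: "q \<in> cdom c" "y = coord c q" using y by (rule cimage_cases)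
    show ?thesis
      using linear_tangent_change[OF R(1) R(2) c R(3) q(1)]
      by (simp add: q local_field_eq[OF R(5)[OF c]] linear_add linear_scale)
  qed
  have "(local_field M c (\<lambda>q. X q + a *\<^sub>R Y q) has_derivative
      (\<lambda>u. frechet_derivative (local_field M c X) (at x) u +
        a *\<^sub>R frechet_derivative (local_field M c Y) (at x) u)) (at x)"
    by (rule has_derivative_transform_within_open[OF
        has_derivative_add[OF DX has_derivative_scaleR_right[OF DY]] open_S x]) (simp add: L)
  from divergence_eq[OF M c_def this[unfolded x_def]]
    divergence_eq[OF M c_def DX[unfolded x_def]] divergence_eq[OF M c_def DY[unfolded x_def]]
  show ?thesis
    using L[OF x] linear_christoffel[OF x]
    by (simp add: x_def[symmetric] lin_trace_add lin_trace_scaleR linear_add linear_scale distrib_left)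
qed

text \<open>The tension field of a real-valued function.\<close>

definition laplacian :: "('a, 'e::euclidean_space) riem \<Rightarrow> ('a \<Rightarrow> real) \<Rightarrow> 'a \<Rightarrow> real" where
  "laplacian M f = divergence M (grad M f)"

lemma grad_lincomb:
  assumes M: "riemannian_manifold M" and f: "smooth_fun M f" and g: "smooth_fun M g"
  shows "grad M (\<lambda>q. f q + a * g q) p = grad M f p + a *\<^sub>R grad M g p"
proof (rule grad_eqI[OF M])
  show "((\<lambda>q. f q + a * g q) \<circ> param (chart_at M p) has_derivative
      (\<lambda>u. differential M f p u + a * differential M g p u)) (at (coord (chart_at M p) p))"
    using has_derivative_add[OF has_derivative_differential[OF M f, of p]
        has_derivative_mult_right[OF has_derivative_differential[OF M g, of p], of a]]
    by (simp add: o_def)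
qed (simp add: metric_grad[OF M] f g inner_form_simps[OF riemannian_manifoldD(4)[OF M]])

lemma laplacian_lincomb:
  assumes "riemannian_manifold M" "smooth_fun M f" "smooth_fun M g"
  shows "laplacian M (\<lambda>q. f q + a * g q) p = laplacian M f p + a * laplacian M g p"
proof -
  have "grad M (\<lambda>q. f q + a * g q) = (\<lambda>q. grad M f q + a *\<^sub>R grad M g q)"
    using grad_lincomb[OF assms] by blast
  then show ?thesis
    using assms by (simp add: laplacian_def divergence_lincomb differentiable_field_grad)
qed

section \<open>Smoothness of products\<close>

lemma Ck_on_SucD: "Ck_on (Suc k) S f \<Longrightarrow> Ck_on k S f"
proof (induction k arbitrary: f)
  case 0
  then show ?case
    by (auto intro!: continuous_at_imp_continuous_on differentiable_imp_continuous_within)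
qed simp

lemma Ck_on_bounded_linear:
  assumes "open S" "bounded_linear P" "Ck_on k S f"
  shows "Ck_on k S (\<lambda>x. P (f x))"
  using assms
proof (induction k arbitrary: f)
  case 0
  then show ?case using bounded_linear.continuous_on[OF assms(2)] by simp
next
  case (Suc k)
  have D: "((\<lambda>x. P (f x)) has_derivative (\<lambda>v. P (frechet_derivative f (at x) v))) (at x)"
    if "x \<in> S" for x
    by (rule bounded_linear.has_derivative[OF assms(2)])
      (use Suc.prems that in \<open>simp flip: frechet_derivative_works\<close>)
  show ?case
  proof (simp, intro conjI ballI allI)
    fix x assume "x \<in> S" then show "(\<lambda>x. P (f x)) differentiable at x"
      using D differentiable_def by blast
  next
    fix v
    have "Ck_on k S (\<lambda>x. P (frechet_derivative f (at x) v))"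
      by (rule Suc.IH) (use Suc.prems in simp_all)
    then show "Ck_on k S (\<lambda>x. frechet_derivative (\<lambda>x. P (f x)) (at x) v)"
      by (rule Ck_on_cong[OF Suc.prems(1), rotated])
        (simp add: frechet_derivative_at[OF D, symmetric])
  qed
qed

lemma Ck_on_mult:
  fixes f g :: "'e::euclidean_space \<Rightarrow> 'f::real_normed_algebra"
  assumes "open S" "Ck_on k S f" "Ck_on k S g"
  shows "Ck_on k S (\<lambda>x. f x * g x)"
  using assms
proof (induction k arbitrary: f g)
  case 0
  then show ?case by (auto intro: continuous_on_mult)
next
  case (Suc k)
  have D: "((\<lambda>x. f x * g x) has_derivative
      (\<lambda>v. f x * frechet_derivative g (at x) v + frechet_derivative f (at x) v * g x)) (at x)"
    if "x \<in> S" for x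
    using Suc.prems that by (auto intro!: has_derivative_mult simp: frechet_derivative_works)
  show ?case
  proof (simp, intro conjI ballI allI)
    fix x assume "x \<in> S" then show "(\<lambda>x. f x * g x) differentiable at x"
      using D differentiable_def by blast
  next
    fix v
    have "Ck_on k S (\<lambda>x. f x * frechet_derivative g (at x) v + frechet_derivative f (at x) v * g x)"
      using Suc Ck_on_SucD[OF Suc.prems(2)] Ck_on_SucD[OF Suc.prems(3)]
      by (auto intro!: Ck_on_add)
    then show "Ck_on k S (\<lambda>x. frechet_derivative (\<lambda>x. f x * g x) (at x) v)"
      by (rule Ck_on_cong[OF Suc.prems(1), rotated])
        (simp add: frechet_derivative_at[OF D, symmetric])
  qed
qed

lemma smooth_fun_bounded_linear:
  assumes "riemannian_manifold M" "bounded_linear P" "smooth_fun M f"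
  shows "smooth_fun M (\<lambda>q. P (f q))"
  using assms(3) Ck_on_bounded_linear[OF riemannian_manifoldD(6)[OF assms(1)] assms(2)]
  unfolding smooth_fun_def smooth_on_def o_def by blast

lemma smooth_fun_prod_mult:
  fixes f :: "'a::{t2_space, second_countable_topology} \<Rightarrow> 'g::real_normed_algebra"
    and g :: "'b::{t2_space, second_countable_topology} \<Rightarrow> 'g"
  assumes M: "riemannian_manifold M\<^sub>1" "riemannian_manifold M\<^sub>2"
    and f: "smooth_fun M\<^sub>1 f" and g: "smooth_fun M\<^sub>2 g"
  shows "smooth_fun (riem_prod M\<^sub>1 M\<^sub>2) (\<lambda>z. f (fst z) * g (snd z))"
  unfolding smooth_fun_def
proof
  fix e assume "e \<in> atlas (riem_prod M\<^sub>1 M\<^sub>2)"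
  then obtain c d where e: "e = prod_chart c d" and c: "c \<in> atlas M\<^sub>1" and d: "d \<in> atlas M\<^sub>2" by auto
  have o: "open (cimage c)" "open (cimage d)"
    using riemannian_manifoldD(6)[OF M(1) c] riemannian_manifoldD(6)[OF M(2) d] .
  have "smooth_on (cimage c \<times> cimage d) (\<lambda>z. (f \<circ> param c) (fst z))"
    "smooth_on (cimage c \<times> cimage d) (\<lambda>z. (g \<circ> param d) (snd z))"
    using f g c d smooth_on_fst[OF o, of "f \<circ> param c"] smooth_on_snd[OF o, of "g \<circ> param d"]
    by (simp_all add: smooth_fun_def)
  then have "smooth_on (cimage c \<times> cimage d) (\<lambda>z. (f \<circ> param c) (fst z) * (g \<circ> param d) (snd z))"
    using Ck_on_mult[OF open_Times[OF o]] unfolding smooth_on_def by blast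
  then show "smooth_on (cimage e) ((\<lambda>z. f (fst z) * g (snd z)) \<circ> param e)"
    unfolding e cimage_prod
    by (rule smooth_on_cong[rotated 2])
      (use o riemannian_manifoldD(5)[OF M(1) c] riemannian_manifoldD(5)[OF M(2) d]
        in \<open>auto simp: param_prod open_Times\<close>)
qed

section \<open>Gradient and divergence on a product\<close>

text \<open>Off-diagonal blocks do not contribute to a trace.\<close>

lemma lin_trace_prod:
  fixes L :: "'e::euclidean_space \<times> 'f::euclidean_space \<Rightarrow> 'e \<times> 'f"
  shows "lin_trace L = lin_trace (\<lambda>u. fst (L (u, 0))) + lin_trace (\<lambda>v. snd (L (0, v)))"
proof -
  have "inj_on (\<lambda>u::'e. (u, 0::'f)) Basis" "inj_on (\<lambda>v::'f. (0::'e, v)) Basis"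
    by (auto intro: inj_onI)
  moreover have "(\<lambda>u::'e. (u, 0::'f)) ` Basis \<inter> (\<lambda>v. (0, v)) ` Basis = {}"
    using nonzero_Basis by auto
  ultimately show ?thesis
    unfolding lin_trace_def Basis_prod_def
    by (subst sum.union_disjoint) (simp_all add: sum.reindex inner_prod_def)
qed

lemma christoffel_prod:
  assumes "metric_on S h\<^sub>1" "metric_on T h\<^sub>2" "metric_on (S \<times> T) h" and x: "x \<in> S" and y: "y \<in> T"
    and h: "\<And>x y u\<^sub>1 u\<^sub>2 v\<^sub>1 v\<^sub>2. x \<in> S \<Longrightarrow> y \<in> T \<Longrightarrow>
      h (x, y) (u\<^sub>1, u\<^sub>2) (v\<^sub>1, v\<^sub>2) = h\<^sub>1 x u\<^sub>1 v\<^sub>1 + h\<^sub>2 y u\<^sub>2 v\<^sub>2"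
  shows "christoffel h (x, y) (u\<^sub>1, u\<^sub>2) (w\<^sub>1, w\<^sub>2) =
    (christoffel h\<^sub>1 x u\<^sub>1 w\<^sub>1, christoffel h\<^sub>2 y u\<^sub>2 w\<^sub>2)"
proof -
  interpret m1: metric_on S h\<^sub>1 by fact
  interpret m2: metric_on T h\<^sub>2 by fact
  interpret m: metric_on "S \<times> T" h by fact
  have xy: "(x, y) \<in> S \<times> T" using x y by simp
  have D: "metric_deriv h (x, y) (a\<^sub>1, a\<^sub>2) (b\<^sub>1, b\<^sub>2) =
      (\<lambda>v. metric_deriv h\<^sub>1 x a\<^sub>1 b\<^sub>1 (fst v) + metric_deriv h\<^sub>2 y a\<^sub>2 b\<^sub>2 (snd v))" for a\<^sub>1 a\<^sub>2 b\<^sub>1 b\<^sub>2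
  proof (rule m.metric_derivI[OF xy])
    show "((\<lambda>z. h\<^sub>1 (fst z) a\<^sub>1 b\<^sub>1 + h\<^sub>2 (snd z) a\<^sub>2 b\<^sub>2) has_derivative
      (\<lambda>v. metric_deriv h\<^sub>1 x a\<^sub>1 b\<^sub>1 (fst v) + metric_deriv h\<^sub>2 y a\<^sub>2 b\<^sub>2 (snd v))) (at (x, y))"
      using diff_chain_at[of fst fst "(x, y)" "\<lambda>x. h\<^sub>1 x a\<^sub>1 b\<^sub>1" "metric_deriv h\<^sub>1 x a\<^sub>1 b\<^sub>1"]
        diff_chain_at[of snd snd "(x, y)" "\<lambda>y. h\<^sub>2 y a\<^sub>2 b\<^sub>2" "metric_deriv h\<^sub>2 y a\<^sub>2 b\<^sub>2"]
        m1.metric_deriv_works[OF x, of a\<^sub>1 b\<^sub>1] m2.metric_deriv_works[OF y, of a\<^sub>2 b\<^sub>2]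
      by (auto intro!: has_derivative_add bounded_linear_imp_has_derivative bounded_linear_fst
          bounded_linear_snd simp: o_def)
  qed (use h in auto)
  show ?thesis
  proof (rule m.christoffel_eqI[OF xy])
    fix v :: "'a \<times> 'b"
    show "2 * h (x, y) (christoffel h\<^sub>1 x u\<^sub>1 w\<^sub>1, christoffel h\<^sub>2 y u\<^sub>2 w\<^sub>2) v =
      metric_deriv h (x, y) (w\<^sub>1, w\<^sub>2) v (u\<^sub>1, u\<^sub>2) + metric_deriv h (x, y) v (u\<^sub>1, u\<^sub>2) (w\<^sub>1, w\<^sub>2) -
      metric_deriv h (x, y) (w\<^sub>1, w\<^sub>2) (u\<^sub>1, u\<^sub>2) v"
      using m1.christoffel_works[OF x, of u\<^sub>1 w\<^sub>1 "fst v"] m2.christoffel_works[OF y, of u\<^sub>2 w\<^sub>2 "snd v"]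
      by (cases v) (simp add: h x y D)
  qed
qed

lemma local_field_prod:
  assumes M: "riemannian_manifold M\<^sub>1" "riemannian_manifold M\<^sub>2" and c: "c \<in> atlas M\<^sub>1" and d: "d \<in> atlas M\<^sub>2"
    and x: "x \<in> cimage c" and y: "y \<in> cimage d"
  shows "local_field (riem_prod M\<^sub>1 M\<^sub>2) (prod_chart c d)
      (\<lambda>z. (g (snd z) *\<^sub>R X\<^sub>1 (fst z), f (fst z) *\<^sub>R X\<^sub>2 (snd z))) (x, y) =
    ((g \<circ> param d) y *\<^sub>R local_field M\<^sub>1 c X\<^sub>1 x, (f \<circ> param c) x *\<^sub>R local_field M\<^sub>2 d X\<^sub>2 y)"
proof -
  note R = riemannian_manifoldD[OF M(1)] and Q = riemannian_manifoldD[OF M(2)]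
  have p: "param c x \<in> cdom c" "param d y \<in> cdom d" using x y by (auto simp: coord_param)
  show ?thesis
    using linear_scale[OF linear_tangent_change[OF R(1) R(2) c R(3) p(1)]]
      linear_scale[OF linear_tangent_change[OF Q(1) Q(2) d Q(3) p(2)]]
    by (simp add: local_field_def Let_def param_prod[OF R(5)[OF c] Q(5)[OF d] x y]
        tangent_change_prod[OF R(1) Q(1) R(2) c R(3) p(1) Q(2) d Q(3) p(2)])
qed

text \<open>The two parts of the field are scaled by functions of the other factor. The derivatives of these
  functions enter only the off-diagonal blocks of the covariant derivative, so the divergence does not see
  them.\<close>

lemma divergence_prod:
  assumes M: "riemannian_manifold M\<^sub>1" "riemannian_manifold M\<^sub>2"
    and X: "differentiable_field M\<^sub>1 X\<^sub>1" "differentiable_field M\<^sub>2 X\<^sub>2"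
    and f: "smooth_fun M\<^sub>1 f" and g: "smooth_fun M\<^sub>2 g"
  shows "divergence (riem_prod M\<^sub>1 M\<^sub>2)
      (\<lambda>z. (g (snd z) *\<^sub>R X\<^sub>1 (fst z), f (fst z) *\<^sub>R X\<^sub>2 (snd z))) (p, q) =
    g q * divergence M\<^sub>1 X\<^sub>1 p + f p * divergence M\<^sub>2 X\<^sub>2 q"
proof -
  note R = riemannian_manifoldD[OF M(1)] and Q = riemannian_manifoldD[OF M(2)]
  define c where "c = chart_at M\<^sub>1 p"
  define d where "d = chart_at M\<^sub>2 q"
  define x where "x = coord c p"
  define y where "y = coord d q"
  have c: "c \<in> atlas M\<^sub>1" and d: "d \<in> atlas M\<^sub>2" and x: "x \<in> cimage c" and y: "y \<in> cimage d"
    using R(2,3) Q(2,3) by (simp_all add: c_def d_def x_def y_def coord_in_cimage)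
  have fx: "f (param c x) = f p" and gy: "g (param d y) = g q"
    by (simp_all add: x_def y_def c_def d_def param_coord R(2,3,5) Q(2,3,5))
  define F where "F = f \<circ> param c"
  define G where "G = g \<circ> param d"
  define A where "A = local_field M\<^sub>1 c X\<^sub>1"
  define B where "B = local_field M\<^sub>2 d X\<^sub>2"
  define h where "h = local_metric (riem_prod M\<^sub>1 M\<^sub>2) (prod_chart c d)"
  define Z where "Z = (\<lambda>z. (g (snd z) *\<^sub>R X\<^sub>1 (fst z), f (fst z) *\<^sub>R X\<^sub>2 (snd z)))"
  obtain F' G' A' B' where D: "(F has_derivative F') (at x)" "(G has_derivative G') (at y)"
    "(A has_derivative A') (at x)" "(B has_derivative B') (at y)"
    using smooth_fun_differentiable[OF f c x] smooth_fun_differentiable[OF g d y]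
      has_derivative_local_field[OF M(1) X(1) c x] has_derivative_local_field[OF M(2) X(2) d y]
    unfolding F_def G_def A_def B_def differentiable_def by blast
  have D2: "((\<lambda>z. F (fst z)) has_derivative (\<lambda>v. F' (fst v))) (at (x, y))"
    "((\<lambda>z. G (snd z)) has_derivative (\<lambda>v. G' (snd v))) (at (x, y))"
    "((\<lambda>z. A (fst z)) has_derivative (\<lambda>v. A' (fst v))) (at (x, y))"
    "((\<lambda>z. B (snd z)) has_derivative (\<lambda>v. B' (snd v))) (at (x, y))"
    using diff_chain_at[OF bounded_linear_imp_has_derivative[OF bounded_linear_fst], of F F' "(x, y)"]
      diff_chain_at[OF bounded_linear_imp_has_derivative[OF bounded_linear_snd], of G G' "(x, y)"]
      diff_chain_at[OF bounded_linear_imp_has_derivative[OF bounded_linear_fst], of A A' "(x, y)"]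
      diff_chain_at[OF bounded_linear_imp_has_derivative[OF bounded_linear_snd], of B B' "(x, y)"] D
    by (auto simp: o_def)
  have op: "open (cimage c \<times> cimage d)" using R(6)[OF c] Q(6)[OF d] by (rule open_Times)
  have loc: "local_field (riem_prod M\<^sub>1 M\<^sub>2) (prod_chart c d) Z z =
      (G (snd z) *\<^sub>R A (fst z), F (fst z) *\<^sub>R B (snd z))" if "z \<in> cimage c \<times> cimage d" for z
    using that local_field_prod[OF M c d, of "fst z" "snd z" g X\<^sub>1 f X\<^sub>2]
    unfolding Z_def F_def G_def A_def B_def by auto
  \<comment> \<open>The product rule: \<open>G'\<close> and \<open>F'\<close> stand in the off-diagonal blocks of \<open>E\<close>.\<close>
  define E where "E v = (G y *\<^sub>R A' (fst v) + G' (snd v) *\<^sub>R A x,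
     F x *\<^sub>R B' (snd v) + F' (fst v) *\<^sub>R B y)" for v
  have xy: "(x, y) \<in> cimage c \<times> cimage d" using x y by simp
  have "((\<lambda>z. (G (snd z) *\<^sub>R A (fst z), F (fst z) *\<^sub>R B (snd z))) has_derivative E) (at (x, y))"
    using has_derivative_Pair[OF has_derivative_scaleR[OF D2(2) D2(3)] has_derivative_scaleR[OF D2(1) D2(4)]]
    by (simp add: E_def[abs_def])
  then have DZ: "(local_field (riem_prod M\<^sub>1 M\<^sub>2) (prod_chart c d) Z has_derivative E) (at (x, y))"
    by (rule has_derivative_transform_within_open[OF _ op xy]) (simp add: loc)
  have pc: "prod_chart c d = chart_at (riem_prod M\<^sub>1 M\<^sub>2) (p, q)"
    by (simp add: c_def d_def)
  have pd: "prod_chart c d \<in> atlas (riem_prod M\<^sub>1 M\<^sub>2)" using c d by auto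
  have co: "coord (prod_chart c d) (p, q) = (x, y)" by (simp add: x_def y_def)
  have \<Gamma>: "christoffel h (x, y) (u\<^sub>1, u\<^sub>2) (w\<^sub>1, w\<^sub>2) =
      (christoffel (local_metric M\<^sub>1 c) x u\<^sub>1 w\<^sub>1, christoffel (local_metric M\<^sub>2 d) y u\<^sub>2 w\<^sub>2)" for u\<^sub>1 u\<^sub>2 w\<^sub>1 w\<^sub>2
    unfolding h_def
    by (rule christoffel_prod[OF metric_on_local_metric[OF M(1) c] metric_on_local_metric[OF M(2) d] _ x y
        local_metric_prod[OF M c d]])
      (use metric_on_local_metric[OF riemannian_manifold_prod[OF M] pd] in simp_all)
  have lin: "linear (christoffel (local_metric M\<^sub>1 c) x u)" "linear (christoffel (local_metric M\<^sub>2 d) y v)" for u v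
    using metric_on.linear_christoffel[OF metric_on_local_metric[OF M(1) c] x]
      metric_on.linear_christoffel[OF metric_on_local_metric[OF M(2) d] y] by auto
  have "linear F'" "linear G'" using D(1,2) has_derivative_linear by auto
  then have "F' 0 = 0" "G' 0 = 0" by (simp_all add: linear_0)
  moreover have "F x = f p" "G y = g q" by (simp_all add: F_def G_def fx gy)
  moreover have "divergence M\<^sub>1 X\<^sub>1 p = lin_trace A' +
      lin_trace (\<lambda>u. christoffel (local_metric M\<^sub>1 c) x u (A x))"
    using divergence_eq[OF M(1) c_def, of X\<^sub>1 A'] D(3) unfolding A_def x_def by simp
  moreover have "divergence M\<^sub>2 X\<^sub>2 q = lin_trace B' +
      lin_trace (\<lambda>u. christoffel (local_metric M\<^sub>2 d) y u (B y))"
    using divergence_eq[OF M(2) d_def, of X\<^sub>2 B'] D(4) unfolding B_def y_def by simp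
  moreover have "divergence (riem_prod M\<^sub>1 M\<^sub>2) Z (p, q) = lin_trace E +
      lin_trace (\<lambda>u. christoffel h (x, y) u (G y *\<^sub>R A x, F x *\<^sub>R B y))"
    using divergence_eq[OF riemannian_manifold_prod[OF M] pc, of Z E] DZ loc[OF xy]
    unfolding co h_def by simp
  ultimately show ?thesis
    unfolding Z_def[symmetric]
    by (simp add: lin_trace_prod[of E] lin_trace_prod[of "\<lambda>u. christoffel h (x, y) u _"] \<Gamma> E_def
        lin_trace_add lin_trace_scaleR linear_scale[OF lin(1)] linear_scale[OF lin(2)] distrib_left)
qed

lemma grad_prod_mult:
  assumes M: "riemannian_manifold M\<^sub>1" "riemannian_manifold M\<^sub>2"
    and f: "smooth_fun M\<^sub>1 f" and g: "smooth_fun M\<^sub>2 g"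
  shows "grad (riem_prod M\<^sub>1 M\<^sub>2) (\<lambda>z. f (fst z) * g (snd z)) (p, q) =
    (g q *\<^sub>R grad M\<^sub>1 f p, f p *\<^sub>R grad M\<^sub>2 g q)"
proof (rule grad_eqI[OF riemannian_manifold_prod[OF M]])
  note R = riemannian_manifoldD[OF M(1)] and Q = riemannian_manifoldD[OF M(2)]
  let ?c = "chart_at M\<^sub>1 p" and ?d = "chart_at M\<^sub>2 q"
  let ?x = "coord ?c p" and ?y = "coord ?d q"
  let ?D = "\<lambda>v. f p * differential M\<^sub>2 g q (snd v) + differential M\<^sub>1 f p (fst v) * g q"
  have "((\<lambda>z. (f \<circ> param ?c) (fst z)) has_derivative (\<lambda>v. differential M\<^sub>1 f p (fst v))) (at (?x, ?y))"
    "((\<lambda>z. (g \<circ> param ?d) (snd z)) has_derivative (\<lambda>v. differential M\<^sub>2 g q (snd v))) (at (?x, ?y))"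
    using diff_chain_at[OF bounded_linear_imp_has_derivative[OF bounded_linear_fst],
        of "f \<circ> param ?c" "differential M\<^sub>1 f p" "(?x, ?y)"]
      diff_chain_at[OF bounded_linear_imp_has_derivative[OF bounded_linear_snd],
        of "g \<circ> param ?d" "differential M\<^sub>2 g q" "(?x, ?y)"]
      has_derivative_differential[OF M(1) f, of p] has_derivative_differential[OF M(2) g, of q]
    by (auto simp: o_def)
  from has_derivative_mult[OF this]
  have "((\<lambda>z. (f \<circ> param ?c) (fst z) * (g \<circ> param ?d) (snd z)) has_derivative ?D) (at (?x, ?y))"
    by (simp add: param_coord R(2,3,5) Q(2,3,5))
  then have "((\<lambda>z. f (fst z) * g (snd z)) \<circ> param (prod_chart ?c ?d) has_derivative ?D) (at (?x, ?y))"
    by (rule has_derivative_transform_within_open[OF _ open_Times[OF R(6)[OF R(2)[of p]] Q(6)[OF Q(2)[of q]]]])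
      (use R Q in \<open>auto simp: param_prod coord_in_cimage\<close>)
  then show "((\<lambda>z. f (fst z) * g (snd z)) \<circ> param (chart_at (riem_prod M\<^sub>1 M\<^sub>2) (p, q)) has_derivative ?D)
      (at (coord (chart_at (riem_prod M\<^sub>1 M\<^sub>2) (p, q)) (p, q)))"
    by simp
  show "metric (riem_prod M\<^sub>1 M\<^sub>2) (p, q) (g q *\<^sub>R grad M\<^sub>1 f p, f p *\<^sub>R grad M\<^sub>2 g q) u = ?D u" for u
    by (cases u) (simp add: inner_form_simps[OF R(4)] inner_form_simps[OF Q(4)]
        metric_grad[OF M(1) f] metric_grad[OF M(2) g])
qed

lemma laplacian_prod_mult:
  assumes M: "riemannian_manifold M\<^sub>1" "riemannian_manifold M\<^sub>2"
    and f: "smooth_fun M\<^sub>1 f" and g: "smooth_fun M\<^sub>2 g"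
  shows "laplacian (riem_prod M\<^sub>1 M\<^sub>2) (\<lambda>z. f (fst z) * g (snd z)) (p, q) =
    g q * laplacian M\<^sub>1 f p + f p * laplacian M\<^sub>2 g q"
proof -
  have "grad (riem_prod M\<^sub>1 M\<^sub>2) (\<lambda>z. f (fst z) * g (snd z)) =
      (\<lambda>z. (g (snd z) *\<^sub>R grad M\<^sub>1 f (fst z), f (fst z) *\<^sub>R grad M\<^sub>2 g (snd z)))"
    using grad_prod_mult[OF assms] by (auto simp: fun_eq_iff)
  then show ?thesis
    unfolding laplacian_def
    using divergence_prod[OF M differentiable_field_grad[OF M(1) f] differentiable_field_grad[OF M(2) g] f g]
    by simp
qed

section \<open>Complex-valued functions on a product\<close>

lemma tension_eq:
  "tension M \<phi> p = Complex (laplacian M (\<lambda>q. Re (\<phi> q)) p) (laplacian M (\<lambda>q. Im (\<phi> q)) p)"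
  by (simp add: tension_def cdivergence_def cgrad_def laplacian_def)

lemma conformality_eq:
  assumes "riemannian_manifold M"
  shows "conformality M \<phi> \<phi> p =
    (let A = grad M (\<lambda>q. Re (\<phi> q)) p; B = grad M (\<lambda>q. Im (\<phi> q)) p
     in Complex (metric M p A A - metric M p B B) (2 * metric M p A B))"
  using inner_form_sym[OF riemannian_manifoldD(4)[OF assms]]
  by (simp add: conformality_def cmetric_def cgrad_def Let_def)

lemma smooth_fun_Re_Im:
  assumes "riemannian_manifold M" "smooth_fun M \<phi>"
  shows "smooth_fun M (\<lambda>q. Re (\<phi> q))" "smooth_fun M (\<lambda>q. Im (\<phi> q))"
  using smooth_fun_bounded_linear[OF assms(1) bounded_linear_Re assms(2)]
    smooth_fun_bounded_linear[OF assms(1) bounded_linear_Im assms(2)] .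

lemma Re_Im_mult:
  "(\<lambda>z. Re (\<phi>\<^sub>1 (fst z) * \<phi>\<^sub>2 (snd z))) =
    (\<lambda>z. Re (\<phi>\<^sub>1 (fst z)) * Re (\<phi>\<^sub>2 (snd z)) + (- 1) * (Im (\<phi>\<^sub>1 (fst z)) * Im (\<phi>\<^sub>2 (snd z))))"
  "(\<lambda>z. Im (\<phi>\<^sub>1 (fst z) * \<phi>\<^sub>2 (snd z))) =
    (\<lambda>z. Re (\<phi>\<^sub>1 (fst z)) * Im (\<phi>\<^sub>2 (snd z)) + 1 * (Im (\<phi>\<^sub>1 (fst z)) * Re (\<phi>\<^sub>2 (snd z))))"
  by (simp_all add: fun_eq_iff)

lemma tension_prod_mult:
  assumes M: "riemannian_manifold M\<^sub>1" "riemannian_manifold M\<^sub>2"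
    and \<phi>: "smooth_fun M\<^sub>1 \<phi>\<^sub>1" "smooth_fun M\<^sub>2 \<phi>\<^sub>2"
  shows "tension (riem_prod M\<^sub>1 M\<^sub>2) (\<lambda>z. \<phi>\<^sub>1 (fst z) * \<phi>\<^sub>2 (snd z)) (p, q) =
    tension M\<^sub>1 \<phi>\<^sub>1 p * \<phi>\<^sub>2 q + \<phi>\<^sub>1 p * tension M\<^sub>2 \<phi>\<^sub>2 q"
proof -
  note S = smooth_fun_Re_Im[OF M(1) \<phi>(1)] smooth_fun_Re_Im[OF M(2) \<phi>(2)]
  note P = smooth_fun_prod_mult[OF M]
  note L = laplacian_prod_mult[OF M]
  show ?thesis
    unfolding tension_eq Re_Im_mult
      laplacian_lincomb[OF riemannian_manifold_prod[OF M] P[OF S(1) S(3)] P[OF S(2) S(4)]]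
      laplacian_lincomb[OF riemannian_manifold_prod[OF M] P[OF S(1) S(4)] P[OF S(2) S(3)]]
      L[OF S(1) S(3)] L[OF S(2) S(4)] L[OF S(1) S(4)] L[OF S(2) S(3)]
    by (simp add: complex_eq_iff algebra_simps)
qed

lemma conformality_prod_mult:
  assumes M: "riemannian_manifold M\<^sub>1" "riemannian_manifold M\<^sub>2"
    and \<phi>: "smooth_fun M\<^sub>1 \<phi>\<^sub>1" "smooth_fun M\<^sub>2 \<phi>\<^sub>2"
  shows "conformality (riem_prod M\<^sub>1 M\<^sub>2) (\<lambda>z. \<phi>\<^sub>1 (fst z) * \<phi>\<^sub>2 (snd z))
      (\<lambda>z. \<phi>\<^sub>1 (fst z) * \<phi>\<^sub>2 (snd z)) (p, q) =
    conformality M\<^sub>1 \<phi>\<^sub>1 \<phi>\<^sub>1 p * (\<phi>\<^sub>2 q)\<^sup>2 + (\<phi>\<^sub>1 p)\<^sup>2 * conformality M\<^sub>2 \<phi>\<^sub>2 \<phi>\<^sub>2 q"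
proof -
  note S = smooth_fun_Re_Im[OF M(1) \<phi>(1)] smooth_fun_Re_Im[OF M(2) \<phi>(2)]
  note P = smooth_fun_prod_mult[OF M]
  note G = grad_prod_mult[OF M]
  note B = riemannian_manifoldD(4)[OF M(1), of p] riemannian_manifoldD(4)[OF M(2), of q]
  define a b c d where "a = grad M\<^sub>1 (\<lambda>q. Re (\<phi>\<^sub>1 q)) p" and "b = grad M\<^sub>1 (\<lambda>q. Im (\<phi>\<^sub>1 q)) p"
    and "c = grad M\<^sub>2 (\<lambda>q. Re (\<phi>\<^sub>2 q)) q" and "d = grad M\<^sub>2 (\<lambda>q. Im (\<phi>\<^sub>2 q)) q"
  show ?thesis
    unfolding conformality_eq[OF riemannian_manifold_prod[OF M]] conformality_eq[OF M(1)]
      conformality_eq[OF M(2)] Re_Im_mult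
      grad_lincomb[OF riemannian_manifold_prod[OF M] P[OF S(1) S(3)] P[OF S(2) S(4)]]
      grad_lincomb[OF riemannian_manifold_prod[OF M] P[OF S(1) S(4)] P[OF S(2) S(3)]]
      G[OF S(1) S(3)] G[OF S(2) S(4)] G[OF S(1) S(4)] G[OF S(2) S(3)]
      a_def[symmetric] b_def[symmetric] c_def[symmetric] d_def[symmetric] Let_def
    using inner_form_sym[OF B(1), of b a] inner_form_sym[OF B(2), of d c]
    by (simp add: complex_eq_iff inner_form_simps[OF B(1)] inner_form_simps[OF B(2)]
        power2_eq_square algebra_simps)
qed

section \<open>Products of eigenfunctions\<close>

theorem theorem7p7:
  fixes M\<^sub>1 :: "('a::{t2_space, second_countable_topology}, 'e::euclidean_space) riem"
    and M\<^sub>2 :: "('b::{t2_space, second_countable_topology}, 'f::euclidean_space) riem"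
    and N :: "('a \<times> 'b, 'e \<times> 'f) riem"
    and \<phi>\<^sub>1 :: "'a \<Rightarrow> complex" and \<phi>\<^sub>2 :: "'b \<Rightarrow> complex"
    and \<psi> :: "'a \<times> 'b \<Rightarrow> complex"
    and l\<^sub>1 \<mu>\<^sub>1 l\<^sub>2 \<mu>\<^sub>2 :: complex
  assumes "riemannian_manifold M\<^sub>1" and "riemannian_manifold M\<^sub>2"
    and "N = riem_prod M\<^sub>1 M\<^sub>2"
    and "eigenfunction M\<^sub>1 \<phi>\<^sub>1" and "eigenfunction M\<^sub>2 \<phi>\<^sub>2"
    and "\<forall>p. tension M\<^sub>1 \<phi>\<^sub>1 p = l\<^sub>1 * \<phi>\<^sub>1 p"
    and "\<forall>p. conformality M\<^sub>1 \<phi>\<^sub>1 \<phi>\<^sub>1 p = \<mu>\<^sub>1 * (\<phi>\<^sub>1 p)\<^sup>2"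
    and "\<forall>q. tension M\<^sub>2 \<phi>\<^sub>2 q = l\<^sub>2 * \<phi>\<^sub>2 q"
    and "\<forall>q. conformality M\<^sub>2 \<phi>\<^sub>2 \<phi>\<^sub>2 q = \<mu>\<^sub>2 * (\<phi>\<^sub>2 q)\<^sup>2"
    and "\<forall>p q. \<psi> (p, q) = \<phi>\<^sub>1 p * \<phi>\<^sub>2 q"
  shows "eigenfunction N \<psi> \<and>
    (\<forall>x. tension N \<psi> x = (l\<^sub>1 + l\<^sub>2) * \<psi> x) \<and>
    (\<forall>x. conformality N \<psi> \<psi> x = (\<mu>\<^sub>1 + \<mu>\<^sub>2) * (\<psi> x)\<^sup>2)"
proof -
  note M = assms(1,2)
  have \<phi>: "smooth_fun M\<^sub>1 \<phi>\<^sub>1" "smooth_fun M\<^sub>2 \<phi>\<^sub>2"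
    using assms(4,5) by (auto simp: eigenfunction_def)
  have \<psi>: "\<psi> = (\<lambda>z. \<phi>\<^sub>1 (fst z) * \<phi>\<^sub>2 (snd z))"
    using assms(10) by (auto simp: fun_eq_iff)
  have "smooth_fun N \<psi>"
    unfolding assms(3) \<psi> by (rule smooth_fun_prod_mult[OF M \<phi>])
  moreover have "tension N \<psi> (p, q) = (l\<^sub>1 + l\<^sub>2) * \<psi> (p, q)" for p q
    unfolding assms(3) \<psi> tension_prod_mult[OF M \<phi>] using assms(6,8) by (simp add: algebra_simps)
  moreover have "conformality N \<psi> \<psi> (p, q) = (\<mu>\<^sub>1 + \<mu>\<^sub>2) * (\<psi> (p, q))\<^sup>2" for p q
    unfolding assms(3) \<psi> conformality_prod_mult[OF M \<phi>] using assms(7,9)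
    by (simp add: algebra_simps power_mult_distrib)
  ultimately show ?thesis
    by (auto simp: eigenfunction_def)
qed

end
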